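(* Let $R$ be a Noetherian super-ring with $\mathrm{Kdim}(R_0)<\infty$, let $I_R=RR_1$, and let $M$ be a nonzero finitely generated $R$-supermodule. Suppose that odd elements $z_1,\dots,z_t\in I_R/I_R^2\simeq R_1/R_1^3$ form a longest system of odd parameters of the $\mathsf{gr}_{I_R}(R)$-supermodule $\mathsf{gr}_{I_R}(M)$. Then any representatives $y_1,\dots,y_t\in R_1$ of $z_1,\dots,z_t$ form a longest system of odd parameters of $M$.
   Context: A super-ring is a unital associative $\mathbb{Z}_2$-graded ring $R=R_0\oplus R_1$; all super-rings are super-commutative ($ab=(-1)^{|a||b|}ba$ for homogeneous $a,b$, and $a^2=0$ for odd $a$). Supermodules are $\mathbb{Z}_2$-graded modules. Noetherian means the ascending chain condition on superideals ($\mathbb{Z}_2$-graded ideals). For a Noetherian super-ring $S$ with $\mathrm{Kdim}(S_0)<\infty$ and a nonzero $S$-supermodule $N$: $\dim(N)=\mathrm{Kdim}(S_0/\mathrm{Ann}_{S_0}(N))$ (with $\dim(0)=-\infty$); a collection $y_1,\dots,y_l\in S_1$ ($l\ge1$) is a system of odd parameters of $N$ if $\dim(y_1\cdots y_l N)=\dim(N)$; it is longest if no system of odd parameters of $N$ has larger length. $\mathsf{gr}_{I_R}(R)=\bigoplus_{n\ge0}I_R^n/I_R^{n+1}$ is a super-ring (again Noetherian with even part of finite Krull dimension) and $\mathsf{gr}_{I_R}(M)=\bigoplus_{n\ge0}I_R^nM/I_R^{n+1}M$ is a $\mathsf{gr}_{I_R}(R)$-supermodule. Since $I_R=R_1^2\oplus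 R_1$ and $I_R^2=R_1^2\oplus R_1^3$, the degree-one component $I_R/I_R^2$ is purely odd and is identified with $R_1/R_1^3$. *)

theory Defs
  imports "HOL-Algebra.Algebra" "HOL-Library.Extended_Real" "HOL-Library.Z2"
begin

section \<open>Super-rings and supermodules\<close>

text \<open>
  The type \<^typ>\<open>bit\<close> of integers modulo 2 indexes the \<open>\<int>\<^sub>2\<close>-gradings, so degrees of
  products and signs are computed by its addition and multiplication.
\<close>

record 'a super_ring = "'a ring" +
  grade :: "bit \<Rightarrow> 'a set"

record ('a, 'b) super_module = "('a, 'b) module" +
  mgrade :: "bit \<Rightarrow> 'b set"

definition z2_decomposition :: "('a, 'm) ring_scheme \<Rightarrow> (bit \<Rightarrow> 'a set) \<Rightarrow> bool" where
  "z2_decomposition G A \<longleftrightarrow>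
     (\<forall>i. additive_subgroup (A i) G) \<and>
     A 0 \<inter> A 1 = {\<zero>\<^bsub>G\<^esub>} \<and>
     carrier G = A 0 <+>\<^bsub>G\<^esub> A 1"

locale super_ring = ring R for R :: "('a, 'm) super_ring_scheme" (structure) +
  assumes decomposition: "z2_decomposition R (grade R)"
    and grade_mult: "\<lbrakk>a \<in> grade R i; b \<in> grade R j\<rbrakk> \<Longrightarrow> a \<otimes> b \<in> grade R (i + j)"
    and super_comm: "\<lbrakk>a \<in> grade R i; b \<in> grade R j\<rbrakk> \<Longrightarrow>
      a \<otimes> b = (if i * j = 1 then \<ominus> (b \<otimes> a) else b \<otimes> a)"
    and odd_square: "a \<in> grade R 1 \<Longrightarrow> a \<otimes> a = \<zero>"

text \<open>
  Left supermodules. The library locale \<open>module\<close> is not applicable because it asks for a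
  commutative ring of scalars; the module axioms below are the same.
\<close>

locale supermodule = R?: super_ring R + M?: abelian_group M
  for R :: "('a, 'm) super_ring_scheme" (structure)
    and M :: "('a, 'b, 'k) super_module_scheme" (structure) +
  assumes smult_closed: "\<lbrakk>a \<in> carrier R; x \<in> carrier M\<rbrakk> \<Longrightarrow> a \<odot>\<^bsub>M\<^esub> x \<in> carrier M"
    and smult_l_distr: "\<lbrakk>a \<in> carrier R; b \<in> carrier R; x \<in> carrier M\<rbrakk> \<Longrightarrow>
      (a \<oplus> b) \<odot>\<^bsub>M\<^esub> x = a \<odot>\<^bsub>M\<^esub> x \<oplus>\<^bsub>M\<^esub> b \<odot>\<^bsub>M\<^esub> x"
    and smult_r_distr: "\<lbrakk>a \<in> carrier R; x \<in> carrier M; y \<in> carrier M\<rbrakk> \<Longrightarrow>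
      a \<odot>\<^bsub>M\<^esub> (x \<oplus>\<^bsub>M\<^esub> y) = a \<odot>\<^bsub>M\<^esub> x \<oplus>\<^bsub>M\<^esub> a \<odot>\<^bsub>M\<^esub> y"
    and smult_assoc: "\<lbrakk>a \<in> carrier R; b \<in> carrier R; x \<in> carrier M\<rbrakk> \<Longrightarrow>
      (a \<otimes> b) \<odot>\<^bsub>M\<^esub> x = a \<odot>\<^bsub>M\<^esub> (b \<odot>\<^bsub>M\<^esub> x)"
    and smult_one: "x \<in> carrier M \<Longrightarrow> \<one> \<odot>\<^bsub>M\<^esub> x = x"
    and mdecomposition: "z2_decomposition M (mgrade M)"
    and mgrade_smult: "\<lbrakk>a \<in> grade R i; x \<in> mgrade M j\<rbrakk> \<Longrightarrow> a \<odot>\<^bsub>M\<^esub> x \<in> mgrade M (i + j)"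

definition superideal :: "'a set \<Rightarrow> ('a, 'm) super_ring_scheme \<Rightarrow> bool" where
  "superideal I R \<longleftrightarrow>
     ideal I R \<and> I = (I \<inter> grade R 0) <+>\<^bsub>R\<^esub> (I \<inter> grade R 1)"

definition noetherian_super_ring :: "('a, 'm) super_ring_scheme \<Rightarrow> bool" where
  "noetherian_super_ring R \<longleftrightarrow>
     super_ring R \<and>
     (\<forall>I :: nat \<Rightarrow> 'a set.
        (\<forall>n. superideal (I n) R) \<and> (\<forall>n. I n \<subseteq> I (Suc n)) \<longrightarrow>
        (\<exists>m. \<forall>n\<ge>m. I n = I m))"

definition submodule_of ::
    "'b set \<Rightarrow> ('a, 'm) super_ring_scheme \<Rightarrow> ('a, 'b, 'k) super_module_scheme \<Rightarrow> bool" where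
  "submodule_of B R M \<longleftrightarrow>
     additive_subgroup B M \<and> (\<forall>a\<in>carrier R. \<forall>x\<in>B. a \<odot>\<^bsub>M\<^esub> x \<in> B)"

definition fin_gen ::
    "('a, 'm) super_ring_scheme \<Rightarrow> ('a, 'b, 'k) super_module_scheme \<Rightarrow> bool" where
  "fin_gen R M \<longleftrightarrow>
     (\<exists>A. finite A \<and> A \<subseteq> carrier M \<and>
          carrier M = \<Inter> {B. submodule_of B R M \<and> A \<subseteq> B})"


section \<open>Krull dimension and odd parameters\<close>

text \<open>In \<^typ>\<open>ereal\<close> the supremum of the empty set is \<open>-\<infinity>\<close>, the value at the zero ring.\<close>

definition Kdim :: "('a, 'm) ring_scheme \<Rightarrow> ereal" where
  "Kdim A = Sup {ereal (real n) | n.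
     \<exists>P :: nat \<Rightarrow> 'a set. (\<forall>i\<le>n. primeideal (P i) A) \<and> (\<forall>i<n. P i \<subset> P (Suc i))}"

definition even_ring :: "('a, 'm) super_ring_scheme \<Rightarrow> ('a, 'm) super_ring_scheme" where
  "even_ring S = S\<lparr>carrier := grade S 0\<rparr>"

definition even_ann ::
    "('a, 'm) super_ring_scheme \<Rightarrow> ('a, 'b, 'k) super_module_scheme \<Rightarrow> 'a set" where
  "even_ann S N = {s \<in> grade S 0. \<forall>x\<in>carrier N. s \<odot>\<^bsub>N\<^esub> x = \<zero>\<^bsub>N\<^esub>}"

definition sdim ::
    "('a, 'm) super_ring_scheme \<Rightarrow> ('a, 'b, 'k) super_module_scheme \<Rightarrow> ereal" where
  "sdim S N =
     (if carrier N = {\<zero>\<^bsub>N\<^esub>} then -\<infinity> else Kdim (even_ring S Quot even_ann S N))"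

definition multiple ::
    "'a \<Rightarrow> ('a, 'b, 'k) super_module_scheme \<Rightarrow> ('a, 'b, 'k) super_module_scheme" where
  "multiple a N =
     N\<lparr>carrier := (\<lambda>x. a \<odot>\<^bsub>N\<^esub> x) ` carrier N,
       mgrade := (\<lambda>i. mgrade N i \<inter> (\<lambda>x. a \<odot>\<^bsub>N\<^esub> x) ` carrier N)\<rparr>"

definition ring_prod_list :: "('a, 'm) ring_scheme \<Rightarrow> 'a list \<Rightarrow> 'a" where
  "ring_prod_list S ys = foldr (\<lambda>a b. a \<otimes>\<^bsub>S\<^esub> b) ys \<one>\<^bsub>S\<^esub>"

definition odd_parameters ::
    "('a, 'm) super_ring_scheme \<Rightarrow> ('a, 'b, 'k) super_module_scheme \<Rightarrow> 'a list \<Rightarrow> bool" where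
  "odd_parameters S N ys \<longleftrightarrow>
     ys \<noteq> [] \<and> set ys \<subseteq> grade S 1 \<and>
     sdim S (multiple (ring_prod_list S ys) N) = sdim S N"

definition longest_odd_parameters ::
    "('a, 'm) super_ring_scheme \<Rightarrow> ('a, 'b, 'k) super_module_scheme \<Rightarrow> 'a list \<Rightarrow> bool" where
  "longest_odd_parameters S N ys \<longleftrightarrow>
     odd_parameters S N ys \<and> (\<forall>xs. odd_parameters S N xs \<longrightarrow> length xs \<le> length ys)"


section \<open>Associated graded objects\<close>

definition odd_ideal :: "('a, 'm) super_ring_scheme \<Rightarrow> 'a set" where
  "odd_ideal R = carrier R \<cdot>\<^bsub>R\<^esub> grade R 1"

primrec ideal_power :: "('a, 'm) ring_scheme \<Rightarrow> 'a set \<Rightarrow> nat \<Rightarrow> 'a set" where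
  "ideal_power R I 0 = carrier R"
| "ideal_power R I (Suc n) = I \<cdot>\<^bsub>R\<^esub> ideal_power R I n"

definition ideal_power_mod ::
    "('a, 'm) ring_scheme \<Rightarrow> ('a, 'b, 'k) module_scheme \<Rightarrow> 'a set \<Rightarrow> nat \<Rightarrow> 'b set" where
  "ideal_power_mod R M I n =
     generate (add_monoid M) {a \<odot>\<^bsub>M\<^esub> x | a x. a \<in> ideal_power R I n \<and> x \<in> carrier M}"

text \<open>
  An element of a direct sum of quotients \<open>F n / F (n+1)\<close> is a finitely supported sequence
  whose \<open>n\<close>-th term is a coset of \<open>F (n+1)\<close> in \<open>F n\<close>. The zero of the \<open>n\<close>-th quotient is
  \<open>F (n+1)\<close> itself.
\<close>

definition gr_carrier :: "('a, 'm) ring_scheme \<Rightarrow> (nat \<Rightarrow> 'a set) \<Rightarrow> (nat \<Rightarrow> 'a set) set" where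
  "gr_carrier G F =
     {f. (\<forall>n. f n \<in> (\<lambda>x. F (Suc n) +>\<^bsub>G\<^esub> x) ` F n) \<and> finite {n. f n \<noteq> F (Suc n)}}"

text \<open>
  Products are computed by \<open>(f g) n = (\<Sum>i\<le>n. f i \<cdot> g (n - i))\<close>: the product of the classes
  of \<open>x\<close> and \<open>y\<close> in degrees \<open>i\<close> and \<open>j\<close> is the class of \<open>x y\<close> in degree \<open>i + j\<close>. The quotient
  \<open>F n / F (n+1)\<close> is a subgroup of \<open>G / F (n+1)\<close>, so the sum is formed in the latter
  (\<^const>\<open>finprod\<close>, since \<^const>\<open>A_FactGroup\<close> is a record of type monoid).
  A class in \<open>F n / F (n+1)\<close> is homogeneous of parity \<open>p\<close> if it has a
  representative in \<open>F n\<close> of parity \<open>p\<close>.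
\<close>

definition gr_ring ::
    "('a, 'm) super_ring_scheme \<Rightarrow> 'a set \<Rightarrow> (nat \<Rightarrow> 'a set) super_ring" where
  "gr_ring R I =
     \<lparr>carrier = gr_carrier R (ideal_power R I),
      monoid.mult = (\<lambda>f g n.
        finprod (R A_Mod ideal_power R I (Suc n))
          (\<lambda>i. [mod ideal_power R I (Suc n):] f i \<Otimes>\<^bsub>R\<^esub> g (n - i)) {..n}),
      monoid.one = (\<lambda>n. if n = 0 then ideal_power R I 1 +>\<^bsub>R\<^esub> \<one>\<^bsub>R\<^esub> else ideal_power R I (Suc n)),
      ring.zero = (\<lambda>n. ideal_power R I (Suc n)),
      ring.add = (\<lambda>f g n. f n <+>\<^bsub>R\<^esub> g n),
      grade = (\<lambda>p. {f \<in> gr_carrier R (ideal_power R I).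
        \<forall>n. f n \<in> (\<lambda>x. ideal_power R I (Suc n) +>\<^bsub>R\<^esub> x) ` (ideal_power R I n \<inter> grade R p)})\<rparr>"

definition rcoset_smult ::
    "('a, 'b, 'k) module_scheme \<Rightarrow> 'b set \<Rightarrow> 'a set \<Rightarrow> 'b set \<Rightarrow> 'b set" where
  "rcoset_smult M J A B = (\<Union>a\<in>A. \<Union>b\<in>B. J +>\<^bsub>M\<^esub> (a \<odot>\<^bsub>M\<^esub> b))"

text \<open>
  The fields \<^const>\<open>monoid.mult\<close> and \<^const>\<open>monoid.one\<close> of a module record play no role.
\<close>

definition gr_module ::
    "('a, 'm) super_ring_scheme \<Rightarrow> 'a set \<Rightarrow> ('a, 'b, 'k) super_module_scheme \<Rightarrow>
     (nat \<Rightarrow> 'a set, nat \<Rightarrow> 'b set) super_module" where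
  "gr_module R I M =
     \<lparr>carrier = gr_carrier M (ideal_power_mod R M I),
      monoid.mult = undefined,
      monoid.one = undefined,
      ring.zero = (\<lambda>n. ideal_power_mod R M I (Suc n)),
      ring.add = (\<lambda>f g n. f n <+>\<^bsub>M\<^esub> g n),
      smult = (\<lambda>f h n.
        finprod (M A_Mod ideal_power_mod R M I (Suc n))
          (\<lambda>i. rcoset_smult M (ideal_power_mod R M I (Suc n)) (f i) (h (n - i))) {..n}),
      mgrade = (\<lambda>p. {h \<in> gr_carrier M (ideal_power_mod R M I).
        \<forall>n. h n \<in> (\<lambda>x. ideal_power_mod R M I (Suc n) +>\<^bsub>M\<^esub> x) `
                    (ideal_power_mod R M I n \<inter> mgrade M p)})\<rparr>"

definition gr_degree_one :: "('a, 'm) super_ring_scheme \<Rightarrow> 'a set \<Rightarrow> 'a set \<Rightarrow> nat \<Rightarrow> 'a set" where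
  "gr_degree_one R I c = (\<lambda>n. if n = 1 then c else ideal_power R I (Suc n))"

end

theory Submission
  imports Defs
begin

text \<open>
  Let \<open>I = R R\<^sub>1\<close>. Noetherianity makes \<open>I\<close> generated by finitely many odd elements, so \<open>I\<close> is
  nilpotent, as a product of generators with a repetition vanishes. Every prime of the even part
  of \<open>gr R\<close> contains the nilpotent elements of positive degree; hence, for \<open>y \<in> I\<^sup>t\<close> with class \<open>z\<close>
  in degree \<open>t\<close>, the dimension of \<open>z gr M\<close> is the supremum of lengths of chains of primes of \<open>R\<^sub>0\<close>
  containing \<open>D y = {a. a y I\<^sup>k M \<subseteq> I\<^bsup>k+t+1\<^esup> M for all k}\<close>. As \<open>Ann (y M) \<subseteq> D y\<close>,
  \<open>dim (z gr M) \<le> dim (y M) \<le> dim M\<close>, and nilpotency gives \<open>dim (gr M) = dim M\<close>; so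
  representatives of odd parameters of \<open>gr M\<close> are odd parameters of \<open>M\<close>.

  Conversely let \<open>x\<close> be the product of \<open>s\<close> odd parameters of \<open>M\<close>. An element common to all \<open>D w\<close>,
  with \<open>w\<close> a product of \<open>s\<close> generators, maps \<open>I\<^sup>k M\<close> to \<open>I\<^bsup>k+1\<^esup> M\<close> for \<open>k \<ge> s\<close>, so a power of it
  annihilates \<open>x M\<close>. Since a prime containing the finite intersection of the \<open>D w\<close> contains one
  of them, some \<open>w\<close> yields \<open>s\<close> odd parameters of \<open>gr M\<close>.
\<close>

section \<open>Chains of primes above a set\<close>

text \<open>For an ideal \<open>T\<close> this is the Krull dimension of the quotient by
  \<open>T\<close>, computed without leaving \<open>A\<close>, so that different annihilators can be
  compared inside one ring. The value is \<open>-\<infinity>\<close> when no prime contains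
  \<open>T\<close>.\<close>

definition chain_dim :: "('a, 'm) ring_scheme \<Rightarrow> 'a set \<Rightarrow> ereal" where
  "chain_dim A T = Sup {ereal (real n) | n. \<exists>P :: nat \<Rightarrow> 'a set.
     (\<forall>i\<le>n. primeideal (P i) A \<and> T \<subseteq> P i) \<and> (\<forall>i<n. P i \<subset> P (Suc i))}"

lemma chain_dim_upper:
  assumes "\<And>i. i \<le> n \<Longrightarrow> primeideal (P i) A" "\<And>i. i \<le> n \<Longrightarrow> T \<subseteq> P i"
    and "\<And>i. i < n \<Longrightarrow> P i \<subset> P (Suc i)"
  shows "ereal (real n) \<le> chain_dim A T"
  unfolding chain_dim_def by (rule Sup_upper) (use assms in blast)

lemma chain_dim_least:
  assumes "\<And>n P. \<lbrakk>\<And>i. i \<le> n \<Longrightarrow> primeideal (P i) A; \<And>i. i \<le> n \<Longrightarrow> T \<subseteq> P i;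
      \<And>i. i < n \<Longrightarrow> P i \<subset> P (Suc i)\<rbrakk> \<Longrightarrow> ereal (real n) \<le> d"
  shows "chain_dim A T \<le> d"
  unfolding chain_dim_def
proof (rule Sup_least)
  fix e assume "e \<in> {ereal (real n) | n. \<exists>P :: nat \<Rightarrow> 'a set.
     (\<forall>i\<le>n. primeideal (P i) A \<and> T \<subseteq> P i) \<and> (\<forall>i<n. P i \<subset> P (Suc i))}"
  then obtain n and P :: "nat \<Rightarrow> 'a set" where "e = ereal (real n)"
    and "\<forall>i\<le>n. primeideal (P i) A \<and> T \<subseteq> P i" and "\<forall>i<n. P i \<subset> P (Suc i)"
    by blast
  then show "e \<le> d" using assms[of n P] by blast
qed

text \<open>Every chain of primes above \<open>T\<close> is a chain above \<open>Y\<close>. The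
  hypothesis compares the primes above the sets rather than the sets themselves, so it also covers
  the case where each element of \<open>Y\<close> merely has a power in \<open>T\<close>.\<close>

lemma chain_dim_mono:
  assumes "\<And>P. \<lbrakk>primeideal P A; T \<subseteq> P\<rbrakk> \<Longrightarrow> Y \<subseteq> P"
  shows "chain_dim A T \<le> chain_dim A Y"
  by (rule chain_dim_least, rule chain_dim_upper) (use assms in blast)+

text \<open>Primes are proper, so there is no chain at all, not even one of length zero.\<close>

lemma chain_dim_carrier:
  "chain_dim A (carrier A) = -\<infinity>"
proof -
  have "chain_dim A (carrier A) \<le> -\<infinity>"
  proof (rule chain_dim_least)
    fix n :: nat and P
    assume P: "\<And>i. i \<le> n \<Longrightarrow> primeideal (P i) A" "\<And>i. i \<le> n \<Longrightarrow> carrier A \<subseteq> P i"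
    interpret primeideal "P 0" A using P by simp
    have "carrier A = P 0" using P(2)[of 0] a_subset by blast
    then show "ereal (real n) \<le> -\<infinity>" using I_notcarr by simp
  qed
  then show ?thesis by simp
qed

lemma primeideal_pow:
  fixes n :: nat
  assumes "primeideal P A" "a \<in> carrier A" "a [^]\<^bsub>A\<^esub> n \<in> P"
  shows "a \<in> P"
proof -
  interpret primeideal P A by fact
  show ?thesis using assms(3)
  proof (induct n)
    case 0
    then show ?case using one_imp_carrier I_notcarr by simp
  next
    case (Suc n)
    then show ?case using I_prime[of "a [^]\<^bsub>A\<^esub> n" a] assms(2) by auto
  qed
qed

text \<open>If the bottom prime of a chain contains \<open>D w\<close>, then so does the whole
  chain. Hence every chain above \<open>T\<close> is bounded by the maximum over the finite set
  \<open>W\<close>, and this maximum is attained.\<close>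

lemma chain_dim_finite_cover:
  assumes "finite W" "W \<noteq> {}"
    and "\<And>P. \<lbrakk>primeideal P A; T \<subseteq> P\<rbrakk> \<Longrightarrow> \<exists>w\<in>W. D w \<subseteq> P"
  shows "\<exists>w\<in>W. chain_dim A T \<le> chain_dim A (D w)"
proof -
  have "chain_dim A T \<le> Max ((\<lambda>w. chain_dim A (D w)) ` W)"
  proof (rule chain_dim_least)
    fix n P
    assume P: "\<And>i. i \<le> n \<Longrightarrow> primeideal (P i) A" "\<And>i. i \<le> n \<Longrightarrow> T \<subseteq> P i"
      "\<And>i. i < n \<Longrightarrow> P i \<subset> P (Suc i)"
    obtain w where w: "w \<in> W" "D w \<subseteq> P 0" using assms(3) P(1,2) by blast
    have "D w \<subseteq> P i" if "i \<le> n" for i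
      using that
    proof (induct i)
      case 0
      then show ?case using w(2) by simp
    next
      case (Suc i)
      then show ?case using P(3)[of i] by auto
    qed
    then have "ereal (real n) \<le> chain_dim A (D w)"
      using P(1,3) by (intro chain_dim_upper[where P = P])
    also have "\<dots> \<le> Max ((\<lambda>w. chain_dim A (D w)) ` W)"
      using w(1) assms(1) by simp
    finally show "ereal (real n) \<le> Max ((\<lambda>w. chain_dim A (D w)) ` W)" .
  qed
  moreover have "Max ((\<lambda>w. chain_dim A (D w)) ` W) \<in> (\<lambda>w. chain_dim A (D w)) ` W"
    using assms(1,2) by (intro Max_in) auto
  ultimately show ?thesis by auto
qed

text \<open>If each \<open>D w\<close> had an element outside the prime \<open>P\<close>, the
  product of these elements would lie in every \<open>D w\<close> but not in
  \<open>P\<close>.\<close>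

lemma primeideal_Inter:
  assumes "finite W" "primeideal P A" "\<And>w. w \<in> W \<Longrightarrow> ideal (D w) A"
    and "carrier A \<inter> (\<Inter>w\<in>W. D w) \<subseteq> P"
  shows "\<exists>w\<in>W. D w \<subseteq> P"
proof (rule ccontr)
  assume "\<not> ?thesis"
  then have nD: "\<And>w. w \<in> W \<Longrightarrow> \<not> D w \<subseteq> P" by blast
  interpret primeideal P A by fact
  have "\<exists>a\<in>carrier A. a \<notin> P \<and> (\<forall>w\<in>V. a \<in> D w)" if "finite V" "V \<subseteq> W" for V
    using that
  proof (induct V)
    case empty
    then show ?case using one_imp_carrier I_notcarr by blast
  next
    case (insert v V)
    then obtain a where a: "a \<in> carrier A" "a \<notin> P" "\<forall>w\<in>V. a \<in> D w" by auto
    obtain b where b: "b \<in> D v" "b \<notin> P" using nD insert.prems by blast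
    interpret Dv: ideal "D v" A using assms(3) insert.prems by blast
    have "a \<otimes>\<^bsub>A\<^esub> b \<notin> P" using I_prime a b Dv.Icarr by blast
    moreover have "a \<otimes>\<^bsub>A\<^esub> b \<in> D w" if "w \<in> insert v V" for w
      using that a b Dv.I_l_closed Dv.Icarr ideal.I_r_closed[OF assms(3)] insert.prems by auto
    moreover have "a \<otimes>\<^bsub>A\<^esub> b \<in> carrier A" using a b Dv.Icarr by blast
    ultimately show ?case by blast
  qed
  from this[OF assms(1) subset_refl] assms(4) show False by blast
qed

section \<open>Primes under surjective homomorphisms\<close>

lemma surj_hom_vimage_primeideal:
  assumes "cring A" "cring C" "h \<in> ring_hom A C" "h ` carrier A = carrier C" "primeideal P C"
  shows "primeideal {a \<in> carrier A. h a \<in> P} A"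
proof -
  interpret A: cring A by fact
  interpret C: cring C by fact
  interpret P: primeideal P C by fact
  interpret h: ring_hom_ring A C h by (rule ring_hom_ringI2) (fact A.ring_axioms C.ring_axioms assms(3))+
  show ?thesis
  proof (rule primeidealI)
    show "ideal {a \<in> carrier A. h a \<in> P} A"
    proof (rule idealI)
      show "ring A" by (fact A.ring_axioms)
      show "subgroup {a \<in> carrier A. h a \<in> P} (add_monoid A)"
        by (rule subgroup.intro) (auto simp flip: a_inv_def)
    qed (auto intro: P.I_l_closed P.I_r_closed)
    show "cring A" by fact
    show "carrier A \<noteq> {a \<in> carrier A. h a \<in> P}"
    proof
      assume "carrier A = {a \<in> carrier A. h a \<in> P}"
      then have "carrier C \<subseteq> P"
        unfolding assms(4)[symmetric] by blast
      then show False using P.I_notcarr P.a_subset by blast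
    qed
  qed (use P.I_prime in auto)
qed

text \<open>A prime containing the kernel is a union of fibres of \<open>h\<close>: two elements
  with the same image differ by an element of the kernel. So nothing is lost in passing to the
  image, and primality descends.\<close>

lemma surj_hom_image_primeideal:
  assumes "cring A" "cring C" "h \<in> ring_hom A C" "h ` carrier A = carrier C" "primeideal P A"
    and ker: "\<And>a. \<lbrakk>a \<in> carrier A; h a = \<zero>\<^bsub>C\<^esub>\<rbrakk> \<Longrightarrow> a \<in> P"
  shows "primeideal (h ` P) C" "{a \<in> carrier A. h a \<in> h ` P} = P"
proof -
  interpret A: cring A by fact
  interpret C: cring C by fact
  interpret P: primeideal P A by fact
  interpret h: ring_hom_ring A C h by (rule ring_hom_ringI2) (fact A.ring_axioms C.ring_axioms assms(3))+
  have sat: "a \<in> P" if "a \<in> carrier A" "h a = h p" "p \<in> P" for a p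
  proof -
    have "h (a \<ominus>\<^bsub>A\<^esub> p) = \<zero>\<^bsub>C\<^esub>"
      using that by (simp add: A.minus_eq C.r_neg)
    then have "a \<ominus>\<^bsub>A\<^esub> p \<in> P" using that by (intro ker) auto
    then have "(a \<ominus>\<^bsub>A\<^esub> p) \<oplus>\<^bsub>A\<^esub> p \<in> P" using that by blast
    then show ?thesis using that by (simp add: A.minus_eq A.a_assoc A.l_neg)
  qed
  show eq: "{a \<in> carrier A. h a \<in> h ` P} = P"
    using sat P.Icarr by blast
  show "primeideal (h ` P) C"
  proof (rule primeidealI)
    show "ideal (h ` P) C"
    proof (rule idealI)
      show "ring C" by (fact C.ring_axioms)
      show "subgroup (h ` P) (add_monoid C)"
        by (rule h.img_is_add_subgroup) (fact P.a_subgroup)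
    next
      fix c x assume "c \<in> h ` P" "x \<in> carrier C"
      then obtain p a where "p \<in> P" "c = h p" "a \<in> carrier A" "x = h a"
        using assms(4) by blast
      then show "x \<otimes>\<^bsub>C\<^esub> c \<in> h ` P" "c \<otimes>\<^bsub>C\<^esub> x \<in> h ` P"
        using P.I_l_closed P.I_r_closed by (metis P.Icarr h.hom_mult imageI)+
    qed
    show "cring C" by fact
    show "carrier C \<noteq> h ` P"
      using eq assms(4) P.I_notcarr by blast
  next
    fix x z assume "x \<in> carrier C" "z \<in> carrier C" and xz: "x \<otimes>\<^bsub>C\<^esub> z \<in> h ` P"
    then obtain a b where ab: "a \<in> carrier A" "x = h a" "b \<in> carrier A" "z = h b"
      using assms(4) by blast
    then have "a \<otimes>\<^bsub>A\<^esub> b \<in> P" using xz eq by auto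
    then show "x \<in> h ` P \<or> z \<in> h ` P" using ab P.I_prime by blast
  qed
qed

text \<open>Primes of \<open>C\<close> correspond, strictly monotonically in both directions, to
  primes of \<open>A\<close> above the kernel. As \<open>T\<close> contains zero, the primes above
  the preimage of \<open>T\<close> are among the latter.\<close>

lemma chain_dim_surj_hom:
  assumes "cring A" "cring C" "h \<in> ring_hom A C" "h ` carrier A = carrier C"
    and T: "T \<subseteq> carrier C" "\<zero>\<^bsub>C\<^esub> \<in> T"
  shows "chain_dim C T = chain_dim A {a \<in> carrier A. h a \<in> T}"
proof (rule antisym)
  note hom = assms(1-4)
  show "chain_dim C T \<le> chain_dim A {a \<in> carrier A. h a \<in> T}"
  proof (rule chain_dim_least)
    fix n P
    assume P: "\<And>i. i \<le> n \<Longrightarrow> primeideal (P i) C" "\<And>i. i \<le> n \<Longrightarrow> T \<subseteq> P i"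
      "\<And>i. i < n \<Longrightarrow> P i \<subset> P (Suc i)"
    show "ereal (real n) \<le> chain_dim A {a \<in> carrier A. h a \<in> T}"
    proof (rule chain_dim_upper[where P = "\<lambda>i. {a \<in> carrier A. h a \<in> P i}"])
      fix i assume i: "i < n"
      interpret Pi: primeideal "P (Suc i)" C using P(1) i by simp
      \<comment> \<open>Surjectivity keeps the inclusion strict: an element of
        \<open>P (Suc i)\<close> outside \<open>P i\<close> has a preimage.\<close>
      have "P (Suc i) \<subseteq> h ` carrier A"
        unfolding assms(4) by (fact Pi.a_subset)
      then show "{a \<in> carrier A. h a \<in> P i} \<subset> {a \<in> carrier A. h a \<in> P (Suc i)}"
        using P(3)[OF i] by blast
    next
      show "primeideal {a \<in> carrier A. h a \<in> P i} A" if "i \<le> n" for i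
        using surj_hom_vimage_primeideal[OF hom P(1)[OF that]] .
      show "{a \<in> carrier A. h a \<in> T} \<subseteq> {a \<in> carrier A. h a \<in> P i}" if "i \<le> n" for i
        using P(2)[OF that] by blast
    qed
  qed
  show "chain_dim A {a \<in> carrier A. h a \<in> T} \<le> chain_dim C T"
  proof (rule chain_dim_least)
    fix n P
    assume P: "\<And>i. i \<le> n \<Longrightarrow> primeideal (P i) A"
      "\<And>i. i \<le> n \<Longrightarrow> {a \<in> carrier A. h a \<in> T} \<subseteq> P i"
      "\<And>i. i < n \<Longrightarrow> P i \<subset> P (Suc i)"
    have ker: "a \<in> P i" if "i \<le> n" "a \<in> carrier A" "h a = \<zero>\<^bsub>C\<^esub>" for i a
      using P(2)[OF that(1)] that(2,3) T(2) by auto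
    note img = surj_hom_image_primeideal[OF hom P(1) ker]
    show "ereal (real n) \<le> chain_dim C T"
    proof (rule chain_dim_upper[where P = "\<lambda>i. h ` P i"])
      show "primeideal (h ` P i) C" if "i \<le> n" for i
        using img(1) that by blast
      show "T \<subseteq> h ` P i" if "i \<le> n" for i
      proof
        fix x assume "x \<in> T"
        moreover from this obtain a where "a \<in> carrier A" "x = h a" using T assms(4) by blast
        ultimately show "x \<in> h ` P i" using P(2)[OF that] by blast
      qed
      show "h ` P i \<subset> h ` P (Suc i)" if i: "i < n" for i
      proof (rule psubsetI)
        show "h ` P i \<subseteq> h ` P (Suc i)"
          by (rule image_mono) (use P(3)[OF i] in simp)
        \<comment> \<open>Each prime is recovered from its image, hence distinct primes have
          distinct images.\<close>
        have "{a \<in> carrier A. h a \<in> h ` P j} = P j" if "j \<le> n" for j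
          by (rule img(2)[OF that that])
        then show "h ` P i \<noteq> h ` P (Suc i)"
          using P(3)[OF i] i by (metis Suc_leI less_imp_le psubset_eq)
      qed
    qed
  qed
qed

text \<open>This is the correspondence of primes for the projection to the quotient, applied to the
  zero ideal, whose preimage is \<open>J\<close>.\<close>

lemma Kdim_Quot:
  assumes "cring A" "ideal J A"
  shows "Kdim (A Quot J) = chain_dim A J"
proof -
  interpret J: ideal J A by fact
  have C: "cring (A Quot J)" using J.quotient_is_cring assms(1) by blast
  \<comment> \<open>Every prime contains zero, so \<open>Kdim\<close> counts the same chains as
    \<open>chain_dim\<close> above the zero ideal.\<close>
  have "primeideal P (A Quot J) \<Longrightarrow> {\<zero>\<^bsub>A Quot J\<^esub>} \<subseteq> P" for P
    by (auto dest!: primeideal.axioms(1) ideal.axioms(1) additive_subgroup.zero_closed)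
  then have "Kdim (A Quot J) = chain_dim (A Quot J) {\<zero>\<^bsub>A Quot J\<^esub>}"
    unfolding Kdim_def chain_dim_def by (smt (verit, best) Collect_cong)
  also have "\<dots> = chain_dim A {a \<in> carrier A. J +>\<^bsub>A\<^esub> a \<in> {\<zero>\<^bsub>A Quot J\<^esub>}}"
    by (rule chain_dim_surj_hom[OF assms(1) C J.rcos_ring_hom])
      (use ring.ring_simprules(2)[OF J.quotient_is_ring] in \<open>auto simp: FactRing_simps\<close>)
  also have "{a \<in> carrier A. J +>\<^bsub>A\<^esub> a \<in> {\<zero>\<^bsub>A Quot J\<^esub>}} = J"
    using J.a_rcos_const J.rcos_const_imp_mem by (auto simp: FactRing_def)
  finally show ?thesis .
qed

text \<open>Here \<open>C\<close> carries operations for which no law is assumed. Every element of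
  \<open>C\<close> has the form \<open>h a\<close>, so each ring law is the image of the same law in
  \<open>A\<close>.\<close>

lemma cring_surj_image:
  assumes A: "cring A" and surj: "h ` carrier A = carrier C"
    and mult: "\<And>a b. \<lbrakk>a \<in> carrier A; b \<in> carrier A\<rbrakk> \<Longrightarrow> h a \<otimes>\<^bsub>C\<^esub> h b = h (a \<otimes>\<^bsub>A\<^esub> b)"
    and add: "\<And>a b. \<lbrakk>a \<in> carrier A; b \<in> carrier A\<rbrakk> \<Longrightarrow> h a \<oplus>\<^bsub>C\<^esub> h b = h (a \<oplus>\<^bsub>A\<^esub> b)"
    and one: "\<one>\<^bsub>C\<^esub> = h \<one>\<^bsub>A\<^esub>" and zero: "\<zero>\<^bsub>C\<^esub> = h \<zero>\<^bsub>A\<^esub>"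
  shows "cring C"
proof -
  interpret A: cring A by fact
  have ball: "(\<forall>x\<in>carrier C. Q x) \<longleftrightarrow> (\<forall>a\<in>carrier A. Q (h a))" for Q
    using surj by (metis image_iff)
  have cl: "h a \<in> carrier C" if "a \<in> carrier A" for a using that surj by blast
  have *: "\<forall>x\<in>carrier C. \<forall>y\<in>carrier C. x \<oplus>\<^bsub>C\<^esub> y \<in> carrier C \<and> x \<otimes>\<^bsub>C\<^esub> y \<in> carrier C
      \<and> x \<oplus>\<^bsub>C\<^esub> y = y \<oplus>\<^bsub>C\<^esub> x \<and> x \<otimes>\<^bsub>C\<^esub> y = y \<otimes>\<^bsub>C\<^esub> x"
    unfolding ball by (simp add: mult add cl A.a_comm A.m_comm)
  have **: "\<forall>x\<in>carrier C. \<zero>\<^bsub>C\<^esub> \<oplus>\<^bsub>C\<^esub> x = x \<and> \<one>\<^bsub>C\<^esub> \<otimes>\<^bsub>C\<^esub> x = x \<and> (\<exists>y\<in>carrier C. y \<oplus>\<^bsub>C\<^esub> x = \<zero>\<^bsub>C\<^esub>)"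
    unfolding ball
  proof (intro ballI conjI)
    fix a assume a: "a \<in> carrier A"
    then show "\<exists>y\<in>carrier C. y \<oplus>\<^bsub>C\<^esub> h a = \<zero>\<^bsub>C\<^esub>"
      by (intro bexI[of _ "h (\<ominus>\<^bsub>A\<^esub> a)"]) (simp_all add: add cl zero A.l_neg)
  qed (simp_all add: zero one mult add)
  have ***: "\<forall>x\<in>carrier C. \<forall>y\<in>carrier C. \<forall>z\<in>carrier C.
      x \<oplus>\<^bsub>C\<^esub> y \<oplus>\<^bsub>C\<^esub> z = x \<oplus>\<^bsub>C\<^esub> (y \<oplus>\<^bsub>C\<^esub> z) \<and> x \<otimes>\<^bsub>C\<^esub> y \<otimes>\<^bsub>C\<^esub> z = x \<otimes>\<^bsub>C\<^esub> (y \<otimes>\<^bsub>C\<^esub> z) \<and>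
      (x \<oplus>\<^bsub>C\<^esub> y) \<otimes>\<^bsub>C\<^esub> z = x \<otimes>\<^bsub>C\<^esub> z \<oplus>\<^bsub>C\<^esub> y \<otimes>\<^bsub>C\<^esub> z"
    unfolding ball by (simp add: mult add A.a_assoc A.m_assoc A.l_distr)
  show ?thesis
    by (rule cringI; (rule abelian_groupI | rule comm_monoidI)?)
      (use * ** *** in \<open>auto simp: one zero cl\<close>)
qed

section \<open>Powers of the odd ideal\<close>

lemma ideal_prod_mono:
  assumes "I1 \<subseteq> I2" "J1 \<subseteq> J2"
  shows "I1 \<cdot>\<^bsub>A\<^esub> J1 \<subseteq> I2 \<cdot>\<^bsub>A\<^esub> J2"
proof
  fix a assume "a \<in> I1 \<cdot>\<^bsub>A\<^esub> J1"
  then show "a \<in> I2 \<cdot>\<^bsub>A\<^esub> J2"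
    by induct (use assms in \<open>auto intro: ideal_prod.intros\<close>)
qed

lemma (in ring) ideal_power_is_ideal:
  assumes "ideal I R"
  shows "ideal (ideal_power R I n) R"
  by (induct n) (auto intro: oneideal ideal_prod_is_ideal assms)

lemma (in ring) ideal_power_Suc_subset:
  assumes "ideal I R"
  shows "ideal_power R I (Suc n) \<subseteq> ideal_power R I n"
  using ideal_prod_inter[OF assms ideal_power_is_ideal[OF assms]] by auto

lemma (in ring) ideal_power_antimono:
  assumes "ideal I R" "m \<le> n"
  shows "ideal_power R I n \<subseteq> ideal_power R I m"
  using lift_Suc_antimono_le[of "ideal_power R I" m n] ideal_power_Suc_subset[OF assms(1)] assms(2)
  by blast

lemma (in ring) ideal_power_mult:
  assumes "ideal I R" "a \<in> ideal_power R I m" "b \<in> ideal_power R I n"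
  shows "a \<otimes> b \<in> ideal_power R I (m + n)"
  using assms(2)
proof (induct m arbitrary: a)
  case 0
  then show ?case using ideal.I_l_closed[OF ideal_power_is_ideal] assms by simp
next
  case (Suc m)
  note carr = ideal.Icarr[OF assms(1)] ideal.Icarr[OF ideal_power_is_ideal[OF assms(1)]]
  have "a \<in> I \<cdot> ideal_power R I m" using Suc.prems by simp
  then show ?case
  proof induct
    case (prod u v)
    then have "u \<otimes> (v \<otimes> b) \<in> I \<cdot> ideal_power R I (m + n)"
      by (intro ideal_prod.prod Suc.hyps)
    then show ?case using prod carr assms(3) by (simp add: m_assoc)
  next
    case (sum s1 s2)
    have "s1 \<in> carrier R" "s2 \<in> carrier R"
      using sum ideal_prod_in_carrier[OF assms(1) ideal_power_is_ideal[OF assms(1)]] by blast+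
    then show ?case using sum carr(2)[OF assms(3)]
      by (simp add: l_distr ideal_prod.sum)
  qed
qed

section \<open>The even subring and signs\<close>

lemma even_ring_simps [simp]:
  "carrier (even_ring S) = grade S 0" "monoid.mult (even_ring S) = monoid.mult S"
  "\<one>\<^bsub>even_ring S\<^esub> = \<one>\<^bsub>S\<^esub>" "\<zero>\<^bsub>even_ring S\<^esub> = \<zero>\<^bsub>S\<^esub>" "add (even_ring S) = add S"
  by (simp_all add: even_ring_def)

context super_ring
begin

lemma grade_subgroup: "additive_subgroup (grade R i) R"
  using decomposition unfolding z2_decomposition_def by blast

lemma grade_carrier [simp]: "a \<in> grade R i \<Longrightarrow> a \<in> carrier R"
  using additive_subgroup.a_Hcarr[OF grade_subgroup] .

lemmas grade_add = additive_subgroup.a_closed[OF grade_subgroup]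
  and grade_zero [simp] = additive_subgroup.zero_closed[OF grade_subgroup]
  and grade_neg = additive_subgroup.a_inv_closed[OF grade_subgroup]

lemma grade_even_even: "\<lbrakk>a \<in> grade R 0; b \<in> grade R 0\<rbrakk> \<Longrightarrow> a \<otimes> b \<in> grade R 0"
  and grade_odd_even: "\<lbrakk>a \<in> grade R 1; b \<in> grade R 0\<rbrakk> \<Longrightarrow> a \<otimes> b \<in> grade R 1"
  and grade_odd_odd: "\<lbrakk>a \<in> grade R 1; b \<in> grade R 1\<rbrakk> \<Longrightarrow> a \<otimes> b \<in> grade R 0"
  using grade_mult[of a 0 b 0] grade_mult[of a 1 b 0] grade_mult[of a 1 b 1]
  by simp_all

lemma even_comm: "\<lbrakk>a \<in> grade R 0; b \<in> grade R i\<rbrakk> \<Longrightarrow> a \<otimes> b = b \<otimes> a"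
  using super_comm[of a 0 b i] by simp

lemma odd_anticomm: "\<lbrakk>a \<in> grade R 1; b \<in> grade R 1\<rbrakk> \<Longrightarrow> a \<otimes> b = \<ominus> (b \<otimes> a)"
  using super_comm[of a 1 b 1] by simp

lemma homogeneous_decomp:
  assumes "r \<in> carrier R"
  obtains r0 r1 where "r0 \<in> grade R 0" "r1 \<in> grade R 1" "r = r0 \<oplus> r1"
  using assms decomposition unfolding z2_decomposition_def set_add_def' by auto

lemma even_odd_zero:
  assumes "a \<in> grade R 0" "a \<in> grade R 1"
  shows "a = \<zero>"
  using assms decomposition unfolding z2_decomposition_def by auto

text \<open>Write the unit as \<open>e0 \<oplus> e1\<close>. Multiplying by each component and using
  that \<open>e1\<close> squares to zero gives \<open>e1 = e0 \<otimes> e1\<close> and then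
  \<open>e1 = e0 \<ominus> e0 \<otimes> e0\<close>, which is even. Being odd as well,
  \<open>e1\<close> vanishes.\<close>

lemma one_even: "\<one> \<in> grade R 0"
proof -
  obtain e0 e1 where e: "e0 \<in> grade R 0" "e1 \<in> grade R 1" "\<one> = e0 \<oplus> e1"
    using homogeneous_decomp[OF one_closed] .
  have "e0 = e0 \<otimes> e0 \<oplus> e0 \<otimes> e1" "e1 = e0 \<otimes> e1 \<oplus> e1 \<otimes> e1"
    using e r_distr[of e0 e1 e0] l_distr[of e0 e1 e1] r_one[of e0] l_one[of e1] by auto
  then have "e1 = e0 \<otimes> e1" "e0 = e0 \<otimes> e0 \<oplus> e0 \<otimes> e1"
    using e odd_square[OF e(2)] by simp_all
  then have "e0 = e0 \<otimes> e0 \<oplus> e1" by simp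
  then have "e1 = \<ominus> (e0 \<otimes> e0) \<oplus> e0"
    using e r_neg1[of "e0 \<otimes> e0" e1] by simp
  then have "e1 \<in> grade R 0"
    using e(1) by (metis grade_add grade_neg grade_even_even)
  then have "e1 = \<zero>" using even_odd_zero e by blast
  then show ?thesis using e by simp
qed

lemma even_ring_cring: "cring (even_ring R)"
proof (rule cringI)
  show "abelian_group (even_ring R)"
  proof (rule abelian_groupI)
    show "\<exists>y\<in>carrier (even_ring R). y \<oplus>\<^bsub>even_ring R\<^esub> x = \<zero>\<^bsub>even_ring R\<^esub>"
      if "x \<in> carrier (even_ring R)" for x
      using that by (intro bexI[of _ "\<ominus> x"]) (auto simp: grade_neg l_neg)
  qed (auto simp: grade_add a_ac)
  show "comm_monoid (even_ring R)"
    by (rule comm_monoidI) (auto simp: grade_even_even one_even m_assoc intro: even_comm)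
qed (simp add: l_distr)

lemma finsum_even_ring:
  assumes "finite S" "f \<in> S \<rightarrow> grade R 0"
  shows "finsum (even_ring R) f S = finsum R f S" "finsum R f S \<in> grade R 0"
proof -
  interpret E: cring "even_ring R" by (rule even_ring_cring)
  have "finsum (even_ring R) f S = finsum R f S \<and> finsum R f S \<in> grade R 0"
    using assms
  proof induct
    case (insert s S)
    then have "f s \<in> grade R 0" "f \<in> S \<rightarrow> grade R 0" by auto
    moreover from this have "f s \<in> carrier R" "f \<in> S \<rightarrow> carrier R"
      by (auto dest: funcset_mem intro: grade_carrier)
    ultimately show ?case
      using insert E.finsum_insert[of S s f] finsum_insert[of S s f] by (simp add: grade_add)
  qed simp
  then show "finsum (even_ring R) f S = finsum R f S" "finsum R f S \<in> grade R 0" by auto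
qed

text \<open>The witness \<open>r'\<close> is the image of \<open>r\<close> under the parity
  automorphism, which changes the sign of the odd part.\<close>

lemma odd_mult_swap:
  assumes "a \<in> grade R 1" "r \<in> carrier R"
  obtains r' where "r' \<in> carrier R" "a \<otimes> r = r' \<otimes> a"
proof -
  obtain r0 r1 where r: "r0 \<in> grade R 0" "r1 \<in> grade R 1" "r = r0 \<oplus> r1"
    using homogeneous_decomp[OF assms(2)] .
  then have "a \<otimes> r = (r0 \<ominus> r1) \<otimes> a"
    using assms even_comm[of r0 a 1] odd_anticomm[of a r1]
    by (simp add: r_distr l_distr minus_eq l_minus)
  then show ?thesis using that[of "r0 \<ominus> r1"] r by simp
qed

lemma odd_mult_swap':
  assumes "a \<in> grade R 1" "r \<in> carrier R"
  obtains r' where "r' \<in> carrier R" "r \<otimes> a = a \<otimes> r'"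
proof -
  obtain r0 r1 where r: "r0 \<in> grade R 0" "r1 \<in> grade R 1" "r = r0 \<oplus> r1"
    using homogeneous_decomp[OF assms(2)] .
  then have "r \<otimes> a = a \<otimes> (r0 \<ominus> r1)"
    using assms even_comm[of r0 a 1] odd_anticomm[of r1 a]
    by (simp add: r_distr l_distr minus_eq r_minus)
  then show ?thesis using that[of "r0 \<ominus> r1"] r by simp
qed

text \<open>Odd generators can be moved past any scalar at the cost of a sign on its odd part, so
  the right multiples of \<open>Y\<close> also absorb multiplication from the left. The presence of
  zero keeps the generated set nonempty.\<close>

lemma odd_generated_superideal:
  assumes "Y \<subseteq> grade R 1" "\<zero> \<in> Y"
  shows "superideal (Y \<cdot> carrier R) R"
proof -
  let ?J = "Y \<cdot> carrier R"
  have carr: "?J \<subseteq> carrier R"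
  proof
    fix a assume "a \<in> ?J" then show "a \<in> carrier R"
      by induct (use assms in auto)
  qed
  have l: "x \<otimes> a \<in> ?J" if "a \<in> ?J" "x \<in> carrier R" for a x
    using that
  proof induct
    case (prod y r)
    then obtain x' where x': "x' \<in> carrier R" "x \<otimes> y = y \<otimes> x'"
      using odd_mult_swap' assms by blast
    have "x \<otimes> (y \<otimes> r) = y \<otimes> (x' \<otimes> r)"
      using prod x' assms grade_carrier[of y 1] by (simp flip: m_assoc add: subset_iff)
    then show ?case using prod x' by (simp add: ideal_prod.prod)
  next
    case (sum s1 s2)
    then show ?case using carr by (auto simp: r_distr subset_iff intro: ideal_prod.sum)
  qed
  have r: "a \<otimes> x \<in> ?J" if "a \<in> ?J" "x \<in> carrier R" for a x
    using that
  proof induct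
    case (prod y r)
    then show ?case using assms grade_carrier[of y 1] 
      by (auto simp: m_assoc subset_iff intro: ideal_prod.prod)
  next
    case (sum s1 s2)
    then show ?case using carr by (auto simp: l_distr subset_iff intro: ideal_prod.sum)
  qed
  have ideal: "ideal ?J R"
  proof (rule idealI)
    show "ring R" by (rule ring_axioms)
    show "subgroup ?J (add_monoid R)"
    proof (rule add.subgroupI)
      show "?J \<noteq> {}" using ideal_prod.prod[OF assms(2) zero_closed] by blast
      show "\<ominus> a \<in> ?J" if "a \<in> ?J" for a
        using l[OF that, of "\<ominus> \<one>"] carr that by (auto simp: l_minus subset_iff)
    qed (use carr in \<open>auto intro: ideal_prod.sum\<close>)
  qed (use l r in auto)
  moreover have "?J = (?J \<inter> grade R 0) <+> (?J \<inter> grade R 1)"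
  proof
    show "?J \<subseteq> (?J \<inter> grade R 0) <+> (?J \<inter> grade R 1)"
    proof
      fix a assume "a \<in> ?J"
      then have "\<exists>b\<in>?J \<inter> grade R 0. \<exists>c\<in>?J \<inter> grade R 1. a = b \<oplus> c"
      proof induct
        case (prod y r)
        then obtain r0 r1 where r: "r0 \<in> grade R 0" "r1 \<in> grade R 1" "r = r0 \<oplus> r1"
          using homogeneous_decomp by blast
        have y: "y \<in> grade R 1" using prod assms by blast
        show ?case
          \<comment> \<open>As \<open>y\<close> is odd, the parities are exchanged:
            \<open>y \<otimes> r1\<close> is the even component and \<open>y \<otimes> r0\<close>
            the odd one.\<close>
          by (rule bexI[of _ "y \<otimes> r1"], rule bexI[of _ "y \<otimes> r0"])
            (use r y prod in \<open>auto simp: r_distr a_comm grade_odd_odd grade_odd_even intro: ideal_prod.prod\<close>)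
      next
        case (sum s1 s2)
        then obtain b1 c1 b2 c2 where *: "b1 \<in> ?J \<inter> grade R 0" "c1 \<in> ?J \<inter> grade R 1" "s1 = b1 \<oplus> c1"
          "b2 \<in> ?J \<inter> grade R 0" "c2 \<in> ?J \<inter> grade R 1" "s2 = b2 \<oplus> c2" by blast
        show ?case
          by (rule bexI[of _ "b1 \<oplus> b2"], rule bexI[of _ "c1 \<oplus> c2"])
            (use * in \<open>auto simp: a_ac intro: ideal_prod.sum grade_add\<close>)
      qed
      then show "a \<in> (?J \<inter> grade R 0) <+> (?J \<inter> grade R 1)" unfolding set_add_def' by blast
    qed
    show "(?J \<inter> grade R 0) <+> (?J \<inter> grade R 1) \<subseteq> ?J"
      unfolding set_add_def' by (auto intro: ideal_prod.sum)
  qed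
  ultimately show ?thesis unfolding superideal_def by blast
qed

lemma odd_ideal_eq: "odd_ideal R = grade R 1 \<cdot> carrier R"
proof
  show "odd_ideal R \<subseteq> grade R 1 \<cdot> carrier R"
  proof
    fix a assume "a \<in> odd_ideal R"
    then show "a \<in> grade R 1 \<cdot> carrier R" unfolding odd_ideal_def
    proof induct
      case (prod r y)
      then obtain r' where "r' \<in> carrier R" "r \<otimes> y = y \<otimes> r'" using odd_mult_swap' by blast
      then show ?case using prod by (simp add: ideal_prod.prod)
    qed (rule ideal_prod.sum)
  qed
  show "grade R 1 \<cdot> carrier R \<subseteq> odd_ideal R"
  proof
    fix a assume "a \<in> grade R 1 \<cdot> carrier R"
    then show "a \<in> odd_ideal R" unfolding odd_ideal_def
    proof induct
      case (prod y r)
      then obtain r' where "r' \<in> carrier R" "y \<otimes> r = r' \<otimes> y" using odd_mult_swap by blast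
      then show ?case using prod by (simp add: ideal_prod.prod)
    qed (rule ideal_prod.sum)
  qed
qed

lemma odd_ideal_is_ideal: "ideal (odd_ideal R) R"
  using odd_generated_superideal[of "grade R 1"] unfolding odd_ideal_eq superideal_def by simp

lemma odd_in_odd_ideal: "y \<in> grade R 1 \<Longrightarrow> y \<in> odd_ideal R"
  using ideal_prod.prod[of y "grade R 1" \<one> "carrier R" R] unfolding odd_ideal_eq by simp

section \<open>Finite generation and nilpotency of the odd ideal\<close>

lemma noetherian_odd_generators:
  assumes "noetherian_super_ring R"
  obtains Y where "finite Y" "Y \<subseteq> grade R 1" "\<zero> \<in> Y" "odd_ideal R \<subseteq> Y \<cdot> carrier R"
proof -
  have "\<exists>Y. finite Y \<and> Y \<subseteq> grade R 1 \<and> \<zero> \<in> Y \<and> grade R 1 \<subseteq> Y \<cdot> carrier R"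
  proof (rule ccontr)
    assume none: "\<not> ?thesis"
    define good where "good Y \<longleftrightarrow> finite Y \<and> Y \<subseteq> grade R 1 \<and> \<zero> \<in> Y" for Y
    \<comment> \<open>If no finite set of odd elements suffices, an odd element outside the ideal
      reached so far can always be adjoined. The ideals so obtained form an ascending chain of
      superideals.\<close>
    have "\<exists>Y. \<forall>n. good (Y n) \<and> (\<exists>y\<in>grade R 1. y \<notin> Y n \<cdot> carrier R \<and> Y (Suc n) = insert y (Y n))"
    proof (rule dependent_nat_choice[of "\<lambda>_. good"])
      show "\<exists>Y. good Y" by (rule exI[of _ "{\<zero>}"]) (simp add: good_def)
    next
      fix Y n assume "good Y"
      moreover from this none obtain y where "y \<in> grade R 1" "y \<notin> Y \<cdot> carrier R"
        unfolding good_def by blast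
      ultimately show "\<exists>Y'. good Y' \<and> (\<exists>y\<in>grade R 1. y \<notin> Y \<cdot> carrier R \<and> Y' = insert y Y)"
        by (intro exI[of _ "insert y Y"]) (auto simp: good_def)
    qed
    then obtain Y where Y: "\<And>n. good (Y n)"
      "\<And>n. \<exists>y\<in>grade R 1. y \<notin> Y n \<cdot> carrier R \<and> Y (Suc n) = insert y (Y n)" by blast
    have "superideal (Y n \<cdot> carrier R) R" for n
      using odd_generated_superideal Y(1) unfolding good_def by blast
    moreover have "Y n \<cdot> carrier R \<subseteq> Y (Suc n) \<cdot> carrier R" for n
      by (rule ideal_prod_mono) (use Y(2)[of n] in auto)
    ultimately obtain m where m: "\<forall>n\<ge>m. Y n \<cdot> carrier R = Y m \<cdot> carrier R"
      using assms[unfolded noetherian_super_ring_def, THEN conjunct2, rule_format,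
          of "\<lambda>n. Y n \<cdot> carrier R"] by blast
    obtain y where y: "y \<in> grade R 1" "y \<notin> Y m \<cdot> carrier R" "Y (Suc m) = insert y (Y m)"
      using Y(2) by blast
    \<comment> \<open>The element adjoined at stage \<open>m\<close> lies in the next ideal, which
      by stationarity is the one it was chosen to avoid.\<close>
    have "y \<otimes> \<one> \<in> Y (Suc m) \<cdot> carrier R"
      using y(3) by (intro ideal_prod.prod) auto
    moreover have "Y (Suc m) \<cdot> carrier R = Y m \<cdot> carrier R"
      using m by (meson le_SucI order_refl)
    ultimately show False using y(1,2) by simp
  qed
  then obtain Y where Y: "finite Y" "Y \<subseteq> grade R 1" "\<zero> \<in> Y" "grade R 1 \<subseteq> Y \<cdot> carrier R"
    by (elim exE conjE)
  have id: "ideal (Y \<cdot> carrier R) R"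
    using odd_generated_superideal[OF Y(2,3)] unfolding superideal_def by blast
  have "odd_ideal R \<subseteq> Y \<cdot> carrier R"
  proof
    fix a assume "a \<in> odd_ideal R"
    then show "a \<in> Y \<cdot> carrier R" unfolding odd_ideal_def
    proof induct
      case (prod r y)
      then show ?case using ideal.I_l_closed[OF id] Y(4) by blast
    qed (rule ideal_prod.sum)
  qed
  then show ?thesis using that Y by blast
qed

lemma ring_prod_list_simps [simp]:
  "ring_prod_list R [] = \<one>" "ring_prod_list R (y # ys) = y \<otimes> ring_prod_list R ys"
  by (simp_all add: ring_prod_list_def)

lemma ring_prod_list_power:
  "set ys \<subseteq> odd_ideal R \<Longrightarrow> ring_prod_list R ys \<in> ideal_power R (odd_ideal R) (length ys)"
  by (induct ys) (auto intro: ideal_prod.prod)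

lemma ring_prod_list_closed [simp]:
  "set ys \<subseteq> carrier R \<Longrightarrow> ring_prod_list R ys \<in> carrier R"
  by (induct ys) auto

lemma ring_prod_list_append:
  "\<lbrakk>set xs \<subseteq> carrier R; set ys \<subseteq> carrier R\<rbrakk> \<Longrightarrow>
    ring_prod_list R (xs @ ys) = ring_prod_list R xs \<otimes> ring_prod_list R ys"
  by (induct xs) (auto simp: m_assoc)

text \<open>The power of exponent \<open>s + k\<close> is additively spanned by products of a word
  of \<open>s\<close> generators with an element of the power of exponent \<open>k\<close>. In the
  form of an induction principle, any additively closed \<open>T\<close> containing these products
  contains the whole power.\<close>

lemma ideal_power_words_induct:
  assumes Y: "Y \<subseteq> grade R 1" "odd_ideal R \<subseteq> Y \<cdot> carrier R"
    and T: "\<And>a b. \<lbrakk>a \<in> T; b \<in> T\<rbrakk> \<Longrightarrow> a \<oplus> b \<in> T"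
    and words: "\<And>w c. \<lbrakk>set w \<subseteq> Y; length w = s; c \<in> ideal_power R (odd_ideal R) k\<rbrakk> \<Longrightarrow>
      ring_prod_list R w \<otimes> c \<in> T"
  shows "ideal_power R (odd_ideal R) (s + k) \<subseteq> T"
  using T words
proof (induct s arbitrary: T)
  case 0
  show ?case
  proof
    fix a assume a: "a \<in> ideal_power R (odd_ideal R) (0 + k)"
    then have "ring_prod_list R [] \<otimes> a \<in> T" by (intro 0(2)) auto
    then show "a \<in> T"
      using a ideal.Icarr[OF ideal_power_is_ideal[OF odd_ideal_is_ideal]] by simp
  qed
next
  case (Suc s)
  note pid = ideal_power_is_ideal[OF odd_ideal_is_ideal]
  have step: "y \<otimes> c \<in> T" if y: "y \<in> Y" and c: "c \<in> ideal_power R (odd_ideal R) (s + k)" for y c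
  proof -
    have yc: "y \<in> carrier R" using y Y(1) by auto
    \<comment> \<open>The induction hypothesis is used for the set of all \<open>c\<close> with
      \<open>y \<otimes> c \<in> T\<close>, which trades the first letter of a word for a new target
      set.\<close>
    have "ideal_power R (odd_ideal R) (s + k) \<subseteq> {c \<in> carrier R. y \<otimes> c \<in> T}"
    proof (rule Suc(1))
      fix w c assume w: "set w \<subseteq> Y" "length w = s" "c \<in> ideal_power R (odd_ideal R) k"
      have "ring_prod_list R (y # w) \<otimes> c \<in> T"
        by (rule Suc(3)) (use w y in auto)
      moreover have "set w \<subseteq> carrier R" "c \<in> carrier R"
        using w Y(1) ideal.Icarr[OF pid] by auto
      ultimately show "ring_prod_list R w \<otimes> c \<in> {c \<in> carrier R. y \<otimes> c \<in> T}"
        using yc by (simp add: m_assoc)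
    qed (use Suc(2) yc in \<open>auto simp: r_distr\<close>)
    then show ?thesis using c by blast
  qed
  have uv: "u \<otimes> v \<in> T" if "u \<in> Y \<cdot> carrier R" and v: "v \<in> ideal_power R (odd_ideal R) (s + k)" for u v
    using that(1)
  proof induct
    case (prod y r)
    \<comment> \<open>The coefficient \<open>r\<close> is absorbed into \<open>v\<close>, since the
      power is an ideal.\<close>
    then have "y \<otimes> (r \<otimes> v) \<in> T"
      by (intro step ideal.I_l_closed[OF pid] v)
    then show ?case using prod Y(1) v ideal.Icarr[OF pid] by (auto simp: m_assoc subset_iff)
  next
    case (sum s1 s2)
    have "u \<in> carrier R" if "u \<in> Y \<cdot> carrier R" for u
      using that Y(1) by induct auto
    then show ?case using sum Suc(2) v ideal.Icarr[OF pid] by (auto simp: l_distr)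
  qed
  show ?case
  proof
    fix a assume "a \<in> ideal_power R (odd_ideal R) (Suc s + k)"
    then have "a \<in> odd_ideal R \<cdot> ideal_power R (odd_ideal R) (s + k)" by simp
    then show "a \<in> T"
      by induct (use uv Y(2) Suc(2) in auto)
  qed
qed

text \<open>Moving the first \<open>y\<close> to the right past the letters of \<open>vs\<close>
  only changes signs, until it meets the second \<open>y\<close> and the square vanishes.\<close>

lemma odd_repeated_zero:
  assumes "y \<in> grade R 1" "set vs \<subseteq> grade R 1" "c \<in> carrier R"
  shows "y \<otimes> (ring_prod_list R vs \<otimes> (y \<otimes> c)) = \<zero>"
  using assms(2)
proof (induct vs)
  case Nil
  then show ?case using assms odd_square[OF assms(1)] by (simp flip: m_assoc)
next
  case (Cons v vs)
  then have c: "v \<in> grade R 1" "ring_prod_list R vs \<in> carrier R"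
    by (auto intro!: ring_prod_list_closed intro: grade_carrier)
  let ?w = "ring_prod_list R vs \<otimes> (y \<otimes> c)"
  have w: "?w \<in> carrier R" using c assms by auto
  have "y \<otimes> (ring_prod_list R (v # vs) \<otimes> (y \<otimes> c)) = (y \<otimes> v) \<otimes> ?w"
    using c assms by (simp add: m_assoc)
  also have "\<dots> = \<ominus> (v \<otimes> (y \<otimes> ?w))"
    using odd_anticomm[OF assms(1) c(1)] c(1) assms w by (simp add: m_assoc l_minus)
  also have "\<dots> = \<zero>" using Cons c(1) by simp
  finally show ?case .
qed

lemma odd_word_zero:
  assumes "set w \<subseteq> grade R 1" "\<not> distinct w"
  shows "ring_prod_list R w = \<zero>"
proof -
  obtain us y vs ws where w: "w = us @ [y] @ vs @ [y] @ ws"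
    using not_distinct_decomp[OF assms(2)] by blast
  have sub: "set us \<subseteq> carrier R" "set vs \<subseteq> carrier R" "set ws \<subseteq> carrier R" "y \<in> carrier R"
    using assms(1) w by auto
  have "ring_prod_list R w = ring_prod_list R us \<otimes>
      (y \<otimes> (ring_prod_list R vs \<otimes> (y \<otimes> ring_prod_list R ws)))"
    unfolding w using sub by (simp add: ring_prod_list_append)
  also have "\<dots> = \<zero>"
    using odd_repeated_zero[of y vs "ring_prod_list R ws"] assms(1) w sub by simp
  finally show ?thesis .
qed

text \<open>By the pigeonhole principle a word of \<open>Suc (card Y)\<close> letters from
  \<open>Y\<close> repeats a letter, hence its product is zero; such words span the power.\<close>

lemma odd_ideal_nilpotent:
  assumes Y: "finite Y" "Y \<subseteq> grade R 1" "odd_ideal R \<subseteq> Y \<cdot> carrier R"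
  shows "ideal_power R (odd_ideal R) (Suc (card Y)) = {\<zero>}"
proof
  have "ideal_power R (odd_ideal R) (Suc (card Y) + 0) \<subseteq> {\<zero>}"
  proof (rule ideal_power_words_induct[OF Y(2,3)])
    fix w c assume w: "set w \<subseteq> Y" "length w = Suc (card Y)" "c \<in> ideal_power R (odd_ideal R) 0"
    then have "\<not> distinct w"
      using card_mono[OF Y(1) w(1)] distinct_card by fastforce
    then show "ring_prod_list R w \<otimes> c \<in> {\<zero>}"
      using odd_word_zero[of w] w Y(2) by auto
  qed auto
  then show "ideal_power R (odd_ideal R) (Suc (card Y)) \<subseteq> {\<zero>}" by simp
  show "{\<zero>} \<subseteq> ideal_power R (odd_ideal R) (Suc (card Y))"
    using additive_subgroup.zero_closed[OF ideal.axioms(1)[OF ideal_power_is_ideal[OF odd_ideal_is_ideal]]]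
    by blast
qed

end

section \<open>Representatives in associated graded objects\<close>

declare ideal_power.simps(2) [simp del]

lemma (in abelian_group) abelian_subgroup_of_additive:
  "additive_subgroup H G \<Longrightarrow> abelian_subgroup H G"
  by (rule abelian_subgroupI3) (auto intro: abelian_group_axioms)

lemma (in abelian_group) finsum_in_additive_subgroup:
  assumes "additive_subgroup H G" "finite S" "f \<in> S \<rightarrow> H"
  shows "finsum G f S \<in> H"
proof -
  interpret H: additive_subgroup H G by fact
  show ?thesis using assms(2,3)
  proof induct
    case (insert s S)
    then have "f s \<in> H" "f \<in> S \<rightarrow> H" by auto
    moreover from this have "f s \<in> carrier G" "f \<in> S \<rightarrow> carrier G"
      using H.a_subset by auto
    ultimately show ?case
      using insert finsum_insert[of S s f] by simp
  qed simp
qed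

text \<open>The operations of the associated graded objects add cosets by \<open>finprod\<close>;
  this moves such a sum to representatives.\<close>

lemma (in abelian_subgroup) finprod_A_FactGroup:
  assumes "finite S" "x \<in> S \<rightarrow> carrier G"
  shows "finprod (G A_Mod H) (\<lambda>i. H +> x i) S = H +> finsum G x S"
proof -
  interpret Q: comm_group "G A_Mod H" by (rule a_factorgroup_is_comm_group)
  show ?thesis using assms
  proof induct
    case empty
    have "\<one>\<^bsub>G A_Mod H\<^esub> = H" by (simp add: A_FactGroup_def FactGroup_def)
    then show ?case using a_subset by simp
  next
    case (insert s S)
    have x: "x s \<in> carrier G" "x \<in> S \<rightarrow> carrier G" using insert(4) by (simp_all add: Pi_iff)
    have cos: "H +> y \<in> carrier (G A_Mod H)" if "y \<in> carrier G" for y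
      using a_rcosetsI[OF a_subset that] by (simp add: A_FactGroup_def')
    have "finprod (G A_Mod H) (\<lambda>i. H +> x i) (insert s S) = (H +> x s) <+> (H +> finsum G x S)"
      using insert(1-3) x cos by (subst Q.finprod_insert) (simp_all add: Pi_iff)
    also have "\<dots> = H +> finsum G x (insert s S)"
      using insert(1,2) x by (simp add: a_rcos_sum)
    finally show ?case .
  qed
qed

lemma (in abelian_subgroup) coset_eq_iff:
  assumes "x \<in> carrier G" "y \<in> carrier G"
  shows "H +> x = H +> y \<longleftrightarrow> x \<ominus> y \<in> H"
proof
  assume "H +> x = H +> y"
  then have "x \<in> H +> y" using a_rcos_self[OF assms(1)] by simp
  then show "x \<ominus> y \<in> H" using a_rcos_module_imp[OF assms(2)] by (simp add: minus_eq)
next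
  assume "x \<ominus> y \<in> H"
  then have "x \<in> H +> y" using a_rcos_module_rev[OF assms(2,1)] by (simp add: minus_eq)
  then show "H +> x = H +> y" using a_repr_independence' assms by simp
qed

lemma (in abelian_subgroup) coset_absorb:
  assumes "e \<in> H" "x \<in> carrier G"
  shows "H +> (e \<oplus> x) = H +> x"
  using a_repr_independence'[OF a_rcosI[OF assms(1) a_subset assms(2)] assms(2)] by simp

lemma (in abelian_subgroup) coset_eq_self_iff:
  "x \<in> carrier G \<Longrightarrow> H +> x = H \<longleftrightarrow> x \<in> H"
  using a_rcos_const a_coset_join1[OF _ _ a_subgroup] by blast

text \<open>Calculations in the associated graded objects are carried out on sequences of
  representatives. Finite support is not built in; it comes later from nilpotency.\<close>

definition gr_class :: "('a, 'm) ring_scheme \<Rightarrow> (nat \<Rightarrow> 'a set) \<Rightarrow> (nat \<Rightarrow> 'a) \<Rightarrow> nat \<Rightarrow> 'a set" where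
  "gr_class G F a = (\<lambda>n. F (Suc n) +>\<^bsub>G\<^esub> a n)"

lemma gr_carrierE:
  assumes "f \<in> gr_carrier G F"
  obtains a where "\<And>n. a n \<in> F n" "f = gr_class G F a"
proof -
  have "\<forall>n. \<exists>x. x \<in> F n \<and> f n = F (Suc n) +>\<^bsub>G\<^esub> x" using assms unfolding gr_carrier_def by blast
  then show ?thesis using that unfolding gr_class_def by metis
qed

text \<open>From degree \<open>N\<close> on the filtration is zero, so the representatives vanish
  there and the class has finite support.\<close>

lemma (in abelian_group) gr_class_in_carrier:
  assumes "\<And>n. additive_subgroup (F n) G" "\<And>n. F (Suc n) \<subseteq> F n" "F N = {\<zero>}"
    and "\<And>n. a n \<in> F n"
  shows "gr_class G F a \<in> gr_carrier G F"
proof -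
  have "F n = {\<zero>}" if "n \<ge> N" for n
    using lift_Suc_antimono_le[of F N n] assms(2,3) that
      additive_subgroup.zero_closed[OF assms(1)[of n]] by blast
  then have "gr_class G F a n = F (Suc n)" if "n \<ge> N" for n
    using assms(4)[of n] that additive_subgroup.a_subset[OF assms(1)] unfolding gr_class_def
    by simp
  then have "{n. gr_class G F a n \<noteq> F (Suc n)} \<subseteq> {..<N}"
    by (metis (mono_tags, lifting) lessThan_iff mem_Collect_eq not_le subsetI)
  then show ?thesis
    unfolding gr_carrier_def using assms(4) finite_subset[OF _ finite_lessThan]
    by (auto simp: gr_class_def)
qed

section \<open>The filtrations by powers of the odd ideal\<close>

context supermodule
begin

lemma smult_zero_left [simp]: "x \<in> carrier M \<Longrightarrow> \<zero> \<odot>\<^bsub>M\<^esub> x = \<zero>\<^bsub>M\<^esub>"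
  using smult_l_distr[of \<zero> \<zero> x] smult_closed[of \<zero> x] M.add.r_cancel_one'[of "\<zero> \<odot>\<^bsub>M\<^esub> x"]
  by simp

lemma smult_zero_right [simp]: "a \<in> carrier R \<Longrightarrow> a \<odot>\<^bsub>M\<^esub> \<zero>\<^bsub>M\<^esub> = \<zero>\<^bsub>M\<^esub>"
  using smult_r_distr[of a "\<zero>\<^bsub>M\<^esub>" "\<zero>\<^bsub>M\<^esub>"] smult_closed[of a "\<zero>\<^bsub>M\<^esub>"]
    M.add.r_cancel_one'[of "a \<odot>\<^bsub>M\<^esub> \<zero>\<^bsub>M\<^esub>"]
  by simp

lemma smult_minus_right:
  assumes "a \<in> carrier R" "x \<in> carrier M"
  shows "a \<odot>\<^bsub>M\<^esub> (\<ominus>\<^bsub>M\<^esub> x) = \<ominus>\<^bsub>M\<^esub> (a \<odot>\<^bsub>M\<^esub> x)"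
  using smult_r_distr[of a "\<ominus>\<^bsub>M\<^esub> x" x] assms
  by (intro M.minus_equality[symmetric]) (auto simp: M.l_neg smult_closed)

abbreviation "F \<equiv> ideal_power R (odd_ideal R)"
abbreviation "G \<equiv> ideal_power_mod R M (odd_ideal R)"

lemma F_ideal: "ideal (F n) R"
  by (rule ideal_power_is_ideal) (rule odd_ideal_is_ideal)

lemma F_subgroup: "additive_subgroup (F n) R"
  using F_ideal by (rule ideal.axioms)

lemma F_carrier: "a \<in> F n \<Longrightarrow> a \<in> carrier R"
  using ideal.Icarr[OF F_ideal] .

lemma F_antimono: "m \<le> n \<Longrightarrow> F n \<subseteq> F m"
  by (rule ideal_power_antimono) (rule odd_ideal_is_ideal)

lemma F_mult: "\<lbrakk>a \<in> F m; b \<in> F n\<rbrakk> \<Longrightarrow> a \<otimes> b \<in> F (m + n)"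
  by (rule ideal_power_mult) (rule odd_ideal_is_ideal)

lemma G_subgroup: "additive_subgroup (G n) M"
  unfolding ideal_power_mod_def
  by (intro additive_subgroup.intro M.add.generate_is_subgroup) (auto simp: smult_closed F_carrier)

lemma G_carrier: "x \<in> G n \<Longrightarrow> x \<in> carrier M"
  using additive_subgroup.a_Hcarr[OF G_subgroup] .

lemma G_incl: "\<lbrakk>a \<in> F n; x \<in> carrier M\<rbrakk> \<Longrightarrow> a \<odot>\<^bsub>M\<^esub> x \<in> G n"
  unfolding ideal_power_mod_def by (rule generate.incl) blast

lemma G_least:
  assumes "additive_subgroup H M" "\<And>a x. \<lbrakk>a \<in> F n; x \<in> carrier M\<rbrakk> \<Longrightarrow> a \<odot>\<^bsub>M\<^esub> x \<in> H"
  shows "G n \<subseteq> H"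
  unfolding ideal_power_mod_def
  by (rule M.add.generate_subgroup_incl) (use assms additive_subgroup.a_subgroup in auto)

lemma G_antimono: "m \<le> n \<Longrightarrow> G n \<subseteq> G m"
  using F_antimono by (intro G_least G_subgroup G_incl) auto

lemma G_0: "G 0 = carrier M"
  using G_incl[of \<one> 0] smult_one G_carrier by force

text \<open>Together with \<open>G_least\<close> this reduces a claim that \<open>a\<close> maps
  \<open>G n\<close> into a subgroup to the generators of \<open>G n\<close>.\<close>

lemma smult_preimage_subgroup:
  assumes "additive_subgroup H M" "a \<in> carrier R"
  shows "additive_subgroup {x \<in> carrier M. a \<odot>\<^bsub>M\<^esub> x \<in> H} M"
proof -
  interpret H: additive_subgroup H M by fact
  show ?thesis
    by (intro additive_subgroup.intro M.add.subgroupI)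
      (use assms(2) in \<open>auto simp: smult_r_distr smult_minus_right intro: exI[of _ "\<zero>\<^bsub>M\<^esub>"]\<close>)
qed

lemma F_smult_G:
  assumes "a \<in> F m" "x \<in> G n"
  shows "a \<odot>\<^bsub>M\<^esub> x \<in> G (m + n)"
proof -
  have "G n \<subseteq> {x \<in> carrier M. a \<odot>\<^bsub>M\<^esub> x \<in> G (m + n)}"
  proof (rule G_least)
    fix b y assume "b \<in> F n" "y \<in> carrier M"
    then show "b \<odot>\<^bsub>M\<^esub> y \<in> {x \<in> carrier M. a \<odot>\<^bsub>M\<^esub> x \<in> G (m + n)}"
      using assms(1) by (simp add: F_carrier smult_closed G_incl F_mult flip: smult_assoc)
  qed (rule smult_preimage_subgroup[OF G_subgroup F_carrier[OF assms(1)]])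
  then show ?thesis using assms(2) by blast
qed

lemma F_abelian_subgroup: "abelian_subgroup (F n) R"
  by (rule R.abelian_subgroup_of_additive) (rule F_subgroup)

lemma G_abelian_subgroup: "abelian_subgroup (G n) M"
  by (rule M.abelian_subgroup_of_additive) (rule G_subgroup)

text \<open>Other representatives have the form \<open>h \<oplus> a\<close> and
  \<open>k \<oplus> b\<close>. In the expanded product every term except
  \<open>a \<otimes> b\<close> has a factor \<open>h\<close> or \<open>k\<close> lying one power
  deeper, so it is absorbed by \<open>F (Suc (i + j))\<close>.\<close>

lemma rcoset_mult_F:
  assumes "a \<in> F i" "b \<in> F j"
  shows "[mod F (Suc (i + j)):] (F (Suc i) +> a) \<Otimes> (F (Suc j) +> b) = F (Suc (i + j)) +> (a \<otimes> b)"
proof -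
  interpret J: abelian_subgroup "F (Suc (i + j))" R by (rule F_abelian_subgroup)
  interpret Fi: abelian_subgroup "F (Suc i)" R by (rule F_abelian_subgroup)
  interpret Fj: abelian_subgroup "F (Suc j)" R by (rule F_abelian_subgroup)
  note carr = assms[THEN F_carrier]
  have "F (Suc (i + j)) +> (a' \<otimes> b') = F (Suc (i + j)) +> (a \<otimes> b)"
    if "a' \<in> F (Suc i) +> a" "b' \<in> F (Suc j) +> b" for a' b'
  proof -
    obtain h k where hk: "h \<in> F (Suc i)" "k \<in> F (Suc j)" "a' = h \<oplus> a" "b' = k \<oplus> b"
      using \<open>a' \<in> _\<close> \<open>b' \<in> _\<close> unfolding a_r_coset_def' by blast
    have hc: "h \<in> carrier R" "k \<in> carrier R" using hk F_carrier by blast+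
    have "k \<in> F j" using hk(2) F_antimono[of j "Suc j"] by auto
    then have "k \<oplus> b \<in> F j"
      by (rule additive_subgroup.a_closed[OF F_subgroup _ assms(2)])
    then have e: "h \<otimes> (k \<oplus> b) \<oplus> a \<otimes> k \<in> F (Suc (i + j))"
      using F_mult[OF hk(1), of "k \<oplus> b" j] F_mult[OF assms(1) hk(2)] by simp
    have "a' \<otimes> b' = h \<otimes> (k \<oplus> b) \<oplus> a \<otimes> k \<oplus> a \<otimes> b"
      unfolding hk using hc carr by (simp add: l_distr r_distr[of _ _ a] R.a_assoc)
    then show ?thesis using J.coset_absorb[OF e] carr by simp
  qed
  moreover have "a \<in> F (Suc i) +> a" "b \<in> F (Suc j) +> b"
    using Fi.a_rcos_self Fj.a_rcos_self carr by auto
  ultimately show ?thesis unfolding rcoset_mult_def by blast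
qed

lemma rcoset_smult_FG:
  assumes "a \<in> F i" "x \<in> G j"
  shows "rcoset_smult M (G (Suc (i + j))) (F (Suc i) +> a) (G (Suc j) +>\<^bsub>M\<^esub> x)
    = G (Suc (i + j)) +>\<^bsub>M\<^esub> (a \<odot>\<^bsub>M\<^esub> x)"
proof -
  interpret J: abelian_subgroup "G (Suc (i + j))" M by (rule G_abelian_subgroup)
  interpret Fi: abelian_subgroup "F (Suc i)" R by (rule F_abelian_subgroup)
  interpret Gj: abelian_subgroup "G (Suc j)" M by (rule G_abelian_subgroup)
  note carr = assms(1)[THEN F_carrier] assms(2)[THEN G_carrier]
  have "G (Suc (i + j)) +>\<^bsub>M\<^esub> (a' \<odot>\<^bsub>M\<^esub> x') = G (Suc (i + j)) +>\<^bsub>M\<^esub> (a \<odot>\<^bsub>M\<^esub> x)"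
    if "a' \<in> F (Suc i) +> a" "x' \<in> G (Suc j) +>\<^bsub>M\<^esub> x" for a' x'
  proof -
    obtain h k where hk: "h \<in> F (Suc i)" "k \<in> G (Suc j)" "a' = h \<oplus> a" "x' = k \<oplus>\<^bsub>M\<^esub> x"
      using \<open>a' \<in> _\<close> \<open>x' \<in> _\<close> unfolding a_r_coset_def' by blast
    have hc: "h \<in> carrier R" "k \<in> carrier M" using hk F_carrier G_carrier by blast+
    have "k \<in> G j" using hk(2) G_antimono[of j "Suc j"] by auto
    then have "k \<oplus>\<^bsub>M\<^esub> x \<in> G j"
      by (rule additive_subgroup.a_closed[OF G_subgroup _ assms(2)])
    then have e: "h \<odot>\<^bsub>M\<^esub> (k \<oplus>\<^bsub>M\<^esub> x) \<oplus>\<^bsub>M\<^esub> a \<odot>\<^bsub>M\<^esub> k \<in> G (Suc (i + j))"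
      using F_smult_G[OF hk(1), of "k \<oplus>\<^bsub>M\<^esub> x" j] F_smult_G[OF assms(1) hk(2)] by simp
    have "a' \<odot>\<^bsub>M\<^esub> x' = h \<odot>\<^bsub>M\<^esub> (k \<oplus>\<^bsub>M\<^esub> x) \<oplus>\<^bsub>M\<^esub> a \<odot>\<^bsub>M\<^esub> k \<oplus>\<^bsub>M\<^esub> a \<odot>\<^bsub>M\<^esub> x"
      unfolding hk using hc carr
      by (simp add: smult_l_distr smult_r_distr[of a] smult_closed M.a_assoc)
    then show ?thesis using J.coset_absorb[OF e] carr by (simp add: smult_closed)
  qed
  moreover have "a \<in> F (Suc i) +> a" "x \<in> G (Suc j) +>\<^bsub>M\<^esub> x"
    using Fi.a_rcos_self Gj.a_rcos_self carr by auto
  ultimately show ?thesis unfolding rcoset_smult_def by blast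
qed

abbreviation "gr_R \<equiv> gr_ring R (odd_ideal R)"
abbreviation "gr_M \<equiv> gr_module R (odd_ideal R) M"

text \<open>All summands in degree \<open>n\<close> are cosets of the same subgroup, because
  \<open>i + (n - i) = n\<close>; so the product is represented by the Cauchy product of the
  representatives.\<close>

lemma gr_ring_mult_class:
  assumes "\<And>n. a n \<in> F n" "\<And>n. b n \<in> F n"
  shows "gr_class R F a \<otimes>\<^bsub>gr_R\<^esub> gr_class R F b = gr_class R F (\<lambda>n. \<Oplus>i\<in>{..n}. a i \<otimes> b (n - i))"
proof
  fix n
  interpret J: abelian_subgroup "F (Suc n)" R by (rule F_abelian_subgroup)
  have "(gr_class R F a \<otimes>\<^bsub>gr_R\<^esub> gr_class R F b) n = finprod (R A_Mod F (Suc n))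
      (\<lambda>i. [mod F (Suc n):] (F (Suc i) +> a i) \<Otimes> (F (Suc (n - i)) +> b (n - i))) {..n}"
    by (simp only: gr_ring_def monoid.simps gr_class_def)
  also have "\<dots> = finprod (R A_Mod F (Suc n)) (\<lambda>i. F (Suc n) +> (a i \<otimes> b (n - i))) {..n}"
  proof (rule comm_monoid.finprod_cong')
    show "comm_monoid (R A_Mod F (Suc n))"
      using J.a_factorgroup_is_comm_group comm_group.axioms(1) by blast
    show "(\<lambda>i. F (Suc n) +> (a i \<otimes> b (n - i))) \<in> {..n} \<rightarrow> carrier (R A_Mod F (Suc n))"
      using R.a_rcosetsI[OF J.a_subset] F_carrier[OF assms(1)] F_carrier[OF assms(2)]
      by (simp add: A_FactGroup_def' Pi_iff)
    show "[mod F (Suc n):] (F (Suc i) +> a i) \<Otimes> (F (Suc (n - i)) +> b (n - i))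
        = F (Suc n) +> (a i \<otimes> b (n - i))" if "i \<in> {..n}" for i
      using rcoset_mult_F[of "a i" i "b (n - i)" "n - i"] assms that by simp
  qed simp
  also have "\<dots> = F (Suc n) +> (\<Oplus>i\<in>{..n}. a i \<otimes> b (n - i))"
    by (rule J.finprod_A_FactGroup) (use assms[THEN F_carrier] in auto)
  finally show "(gr_class R F a \<otimes>\<^bsub>gr_R\<^esub> gr_class R F b) n
      = gr_class R F (\<lambda>n. \<Oplus>i\<in>{..n}. a i \<otimes> b (n - i)) n"
    by (simp only: gr_class_def)
qed

lemma gr_module_smult_class:
  assumes "\<And>n. a n \<in> F n" "\<And>n. x n \<in> G n"
  shows "gr_class R F a \<odot>\<^bsub>gr_M\<^esub> gr_class M G x
    = gr_class M G (\<lambda>n. \<Oplus>\<^bsub>M\<^esub>i\<in>{..n}. a i \<odot>\<^bsub>M\<^esub> x (n - i))"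
proof
  fix n
  interpret J: abelian_subgroup "G (Suc n)" M by (rule G_abelian_subgroup)
  have "(gr_class R F a \<odot>\<^bsub>gr_M\<^esub> gr_class M G x) n = finprod (M A_Mod G (Suc n))
      (\<lambda>i. rcoset_smult M (G (Suc n)) (F (Suc i) +> a i) (G (Suc (n - i)) +>\<^bsub>M\<^esub> x (n - i))) {..n}"
    by (simp only: gr_module_def module.simps gr_class_def)
  also have "\<dots> = finprod (M A_Mod G (Suc n)) (\<lambda>i. G (Suc n) +>\<^bsub>M\<^esub> (a i \<odot>\<^bsub>M\<^esub> x (n - i))) {..n}"
  proof (rule comm_monoid.finprod_cong')
    show "comm_monoid (M A_Mod G (Suc n))"
      using J.a_factorgroup_is_comm_group comm_group.axioms(1) by blast
    show "(\<lambda>i. G (Suc n) +>\<^bsub>M\<^esub> (a i \<odot>\<^bsub>M\<^esub> x (n - i))) \<in> {..n} \<rightarrow> carrier (M A_Mod G (Suc n))"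
      using M.a_rcosetsI[OF J.a_subset] F_carrier[OF assms(1)] G_carrier[OF assms(2)]
      by (simp add: A_FactGroup_def' Pi_iff smult_closed)
    show "rcoset_smult M (G (Suc n)) (F (Suc i) +> a i) (G (Suc (n - i)) +>\<^bsub>M\<^esub> x (n - i))
        = G (Suc n) +>\<^bsub>M\<^esub> (a i \<odot>\<^bsub>M\<^esub> x (n - i))" if "i \<in> {..n}" for i
      using rcoset_smult_FG[of "a i" i "x (n - i)" "n - i"] assms that by simp
  qed simp
  also have "\<dots> = G (Suc n) +>\<^bsub>M\<^esub> (\<Oplus>\<^bsub>M\<^esub>i\<in>{..n}. a i \<odot>\<^bsub>M\<^esub> x (n - i))"
    by (rule J.finprod_A_FactGroup) (use F_carrier[OF assms(1)] G_carrier[OF assms(2)] smult_closed in auto)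
  finally show "(gr_class R F a \<odot>\<^bsub>gr_M\<^esub> gr_class M G x) n
      = gr_class M G (\<lambda>n. \<Oplus>\<^bsub>M\<^esub>i\<in>{..n}. a i \<odot>\<^bsub>M\<^esub> x (n - i)) n"
    by (simp only: gr_class_def)
qed

lemma gr_ring_add_class:
  assumes "\<And>n. a n \<in> F n" "\<And>n. b n \<in> F n"
  shows "gr_class R F a \<oplus>\<^bsub>gr_R\<^esub> gr_class R F b = gr_class R F (\<lambda>n. a n \<oplus> b n)"
proof
  fix n
  interpret J: abelian_subgroup "F (Suc n)" R by (rule F_abelian_subgroup)
  show "(gr_class R F a \<oplus>\<^bsub>gr_R\<^esub> gr_class R F b) n = gr_class R F (\<lambda>n. a n \<oplus> b n) n"
    using J.a_rcos_sum[of "a n" "b n"] assms[THEN F_carrier] by (simp add: gr_ring_def gr_class_def)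
qed

lemma gr_ring_zero: "\<zero>\<^bsub>gr_R\<^esub> = gr_class R F (\<lambda>_. \<zero>)"
  using additive_subgroup.a_subset[OF F_subgroup] by (simp add: gr_ring_def gr_class_def)

lemma gr_ring_one: "\<one>\<^bsub>gr_R\<^esub> = gr_class R F (\<lambda>n. if n = 0 then \<one> else \<zero>)"
  using additive_subgroup.a_subset[OF F_subgroup]
  by (auto simp: gr_ring_def gr_class_def fun_eq_iff)

lemma gr_module_zero: "\<zero>\<^bsub>gr_M\<^esub> = gr_class M G (\<lambda>_. \<zero>\<^bsub>M\<^esub>)"
  using additive_subgroup.a_subset[OF G_subgroup] by (simp add: gr_module_def gr_class_def)

lemma gr_module_class_zero_iff:
  assumes "\<And>n. x n \<in> carrier M"
  shows "gr_class M G x = \<zero>\<^bsub>gr_M\<^esub> \<longleftrightarrow> (\<forall>n. x n \<in> G (Suc n))"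
  using abelian_subgroup.coset_eq_self_iff[OF G_abelian_subgroup] assms
  by (simp add: gr_module_def gr_class_def fun_eq_iff)

end

section \<open>The even part of the associated graded ring\<close>

lemma multiple_simps [simp]:
  "carrier (multiple a N) = (\<lambda>x. a \<odot>\<^bsub>N\<^esub> x) ` carrier N"
  "smult (multiple a N) = smult N" "\<zero>\<^bsub>multiple a N\<^esub> = \<zero>\<^bsub>N\<^esub>"
  by (simp_all add: multiple_def)

lemma coeff_UP: "p \<in> carrier (UP S) \<Longrightarrow> up_ring.coeff (UP S) p n = p n"
  by (simp add: UP_def)

text \<open>For the zero module both sides are \<open>-\<infinity>\<close>, as its annihilator is
  the whole even ring. The hypotheses are chosen so that they can be checked directly for multiples
  of \<open>gr_M\<close>, without a full set of module axioms.\<close>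

lemma sdim_eq_chain_dim:
  assumes "cring (even_ring S)" "ideal (even_ann S N) (even_ring S)"
    and "\<And>s. s \<in> grade S 0 \<Longrightarrow> s \<odot>\<^bsub>N\<^esub> \<zero>\<^bsub>N\<^esub> = \<zero>\<^bsub>N\<^esub>"
  shows "sdim S N = chain_dim (even_ring S) (even_ann S N)"
proof (cases "carrier N = {\<zero>\<^bsub>N\<^esub>}")
  case True
  then have "even_ann S N = carrier (even_ring S)" using assms(3) unfolding even_ann_def by auto
  then show ?thesis using True chain_dim_carrier[of "even_ring S"] unfolding sdim_def by simp
next
  case False
  then show ?thesis using Kdim_Quot[OF assms(1,2)] unfolding sdim_def by simp
qed

context supermodule
begin

section \<open>Convolution sums and homogeneous classes\<close>

lemma finsum_smult_distr:
  assumes "finite S" "f \<in> S \<rightarrow> carrier R" "x \<in> carrier M"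
  shows "(finsum R f S) \<odot>\<^bsub>M\<^esub> x = (\<Oplus>\<^bsub>M\<^esub>i\<in>S. f i \<odot>\<^bsub>M\<^esub> x)"
  using assms(1,2)
proof induct
  case empty
  then show ?case using assms(3) by simp
next
  case (insert s S)
  have f: "f s \<in> carrier R" "f \<in> S \<rightarrow> carrier R" using insert(4) by (simp_all add: Pi_iff)
  then have "(\<lambda>i. f i \<odot>\<^bsub>M\<^esub> x) \<in> S \<rightarrow> carrier M"
    using assms(3) by (simp add: Pi_iff smult_closed)
  then show ?case
    using insert(1-3) f assms(3) R.finsum_insert[OF insert(1,2) f(2,1)]
      M.finsum_insert[OF insert(1,2), of "\<lambda>i. f i \<odot>\<^bsub>M\<^esub> x"]
    by (simp add: smult_l_distr smult_closed)
qed

text \<open>Convolution with a sequence concentrated in degree \<open>t\<close> is a shift by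
  \<open>t\<close> followed by multiplication with \<open>y\<close>.\<close>

lemma finsum_smult_single:
  fixes x :: "nat \<Rightarrow> 'b"
  assumes "y \<in> carrier R" "\<And>n. x n \<in> carrier M"
  shows "(\<Oplus>\<^bsub>M\<^esub>i\<in>{..n}. (if i = t then y else \<zero>) \<odot>\<^bsub>M\<^esub> x (n - i))
    = (if t \<le> n then y \<odot>\<^bsub>M\<^esub> x (n - t) else \<zero>\<^bsub>M\<^esub>)"
proof -
  have "(\<Oplus>\<^bsub>M\<^esub>i\<in>{..n}. (if i = t then y else \<zero>) \<odot>\<^bsub>M\<^esub> x (n - i))
      = (\<Oplus>\<^bsub>M\<^esub>i\<in>{..n}. if t = i then y \<odot>\<^bsub>M\<^esub> x (n - i) else \<zero>\<^bsub>M\<^esub>)"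
    using assms by (intro M.finsum_cong') (auto simp: smult_closed)
  also have "\<dots> = (if t \<le> n then y \<odot>\<^bsub>M\<^esub> x (n - t) else \<zero>\<^bsub>M\<^esub>)"
  proof (cases "t \<le> n")
    case True
    then show ?thesis
      using M.add.finprod_singleton[of t "{..n}" "\<lambda>i. y \<odot>\<^bsub>M\<^esub> x (n - i)", OF _ finite_atMost] assms
      by (simp add: smult_closed Pi_iff)
  next
    case False
    then have "(\<Oplus>\<^bsub>M\<^esub>i\<in>{..n}. if t = i then y \<odot>\<^bsub>M\<^esub> x (n - i) else \<zero>\<^bsub>M\<^esub>) = (\<Oplus>\<^bsub>M\<^esub>i\<in>{..n}. \<zero>\<^bsub>M\<^esub>)"
      by (intro M.finsum_cong') auto
    then show ?thesis using False by simp
  qed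
  finally show ?thesis .
qed

lemma finsum_mult_single:
  fixes b :: "nat \<Rightarrow> 'a"
  assumes "y \<in> carrier R" "\<And>n. b n \<in> carrier R"
  shows "(\<Oplus>i\<in>{..n}. (if i = t then y else \<zero>) \<otimes> b (n - i))
    = (if t \<le> n then y \<otimes> b (n - t) else \<zero>)"
proof -
  have "(\<Oplus>i\<in>{..n}. (if i = t then y else \<zero>) \<otimes> b (n - i))
      = (\<Oplus>i\<in>{..n}. if t = i then y \<otimes> b (n - i) else \<zero>)"
    using assms by (intro R.finsum_cong') auto
  also have "\<dots> = (if t \<le> n then y \<otimes> b (n - t) else \<zero>)"
  proof (cases "t \<le> n")
    case True
    then show ?thesis
      using R.add.finprod_singleton[of t "{..n}" "\<lambda>i. y \<otimes> b (n - i)", OF _ finite_atMost] assms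
      by (simp add: Pi_iff)
  next
    case False
    then have "(\<Oplus>i\<in>{..n}. if t = i then y \<otimes> b (n - i) else \<zero>) = (\<Oplus>i\<in>{..n}. \<zero>)"
      by (intro R.finsum_cong') auto
    then show ?thesis using False by simp
  qed
  finally show ?thesis .
qed

text \<open>For \<open>y \<in> F t\<close> this is the class of \<open>y\<close> placed in degree
  \<open>t\<close>. It may be zero although \<open>y\<close> is not, namely when \<open>y\<close>
  lies in \<open>F (Suc t)\<close>.\<close>

definition homog :: "nat \<Rightarrow> 'a \<Rightarrow> nat \<Rightarrow> 'a set" where
  "homog t y = gr_class R F (\<lambda>n. if n = t then y else \<zero>)"

lemma F_zero [simp]: "\<zero> \<in> F n"
  using additive_subgroup.zero_closed[OF F_subgroup] .

lemma G_zero [simp]: "\<zero>\<^bsub>M\<^esub> \<in> G n"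
  using additive_subgroup.zero_closed[OF G_subgroup] .

lemma homog_mult:
  assumes "y \<in> F s" "y' \<in> F t"
  shows "homog s y \<otimes>\<^bsub>gr_R\<^esub> homog t y' = homog (s + t) (y \<otimes> y')"
proof -
  have "homog s y \<otimes>\<^bsub>gr_R\<^esub> homog t y' = gr_class R F
      (\<lambda>n. \<Oplus>i\<in>{..n}. (if i = s then y else \<zero>) \<otimes> (if n - i = t then y' else \<zero>))"
    unfolding homog_def using assms by (intro gr_ring_mult_class) auto
  also have "\<dots> = gr_class R F (\<lambda>n. if n = s + t then y \<otimes> y' else \<zero>)"
    using finsum_mult_single[of y "\<lambda>n. if n = t then y' else \<zero>"] assms[THEN F_carrier]
    by (intro arg_cong[where f = "gr_class R F"]) (auto simp: fun_eq_iff)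
  finally show ?thesis unfolding homog_def .
qed

text \<open>Degrees add under multiplication, so a product of classes of degree one is the class of
  the product in degree \<open>length ys\<close>. The empty word gives the unit in degree
  zero.\<close>

lemma ring_prod_list_homog:
  assumes "set ys \<subseteq> odd_ideal R"
  shows "ring_prod_list gr_R (map (homog 1) ys) = homog (length ys) (ring_prod_list R ys)"
  using assms
proof (induct ys)
  case Nil
  then show ?case by (simp add: ring_prod_list_def gr_ring_one homog_def)
next
  case (Cons y ys)
  have "y \<in> F 1"
    using Cons.prems ring_prod_list_power[of "[y]"] odd_ideal_is_ideal ideal.Icarr by fastforce
  moreover have "ring_prod_list R ys \<in> F (length ys)"
    using Cons.prems by (intro ring_prod_list_power) auto
  ultimately have "homog 1 y \<otimes>\<^bsub>gr_R\<^esub> homog (length ys) (ring_prod_list R ys)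
      = homog (length (y # ys)) (ring_prod_list R (y # ys))"
    using homog_mult[of y 1] by simp
  then show ?case using Cons by (simp add: ring_prod_list_def)
qed

lemma gr_degree_one_eq_homog:
  "gr_degree_one R (odd_ideal R) (F 2 +> y) = homog 1 y"
  using additive_subgroup.a_subset[OF F_subgroup]
  by (auto simp: gr_degree_one_def homog_def gr_class_def fun_eq_iff numeral_2_eq_2)

lemma grade_gr_ring:
  "grade gr_R p = {f \<in> carrier gr_R. \<exists>a. (\<forall>n. a n \<in> F n \<inter> grade R p) \<and> f = gr_class R F a}"
proof -
  have "(\<forall>n. f n \<in> (\<lambda>x. F (Suc n) +> x) ` (F n \<inter> grade R p)) \<longleftrightarrow>
      (\<exists>a. (\<forall>n. a n \<in> F n \<inter> grade R p) \<and> f = gr_class R F a)" for f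
  proof
    assume "\<forall>n. f n \<in> (\<lambda>x. F (Suc n) +> x) ` (F n \<inter> grade R p)"
    then have "\<forall>n. \<exists>x. x \<in> F n \<inter> grade R p \<and> f n = F (Suc n) +> x" by blast
    then show "\<exists>a. (\<forall>n. a n \<in> F n \<inter> grade R p) \<and> f = gr_class R F a"
      unfolding gr_class_def by (metis (no_types, lifting) ext)
  qed (auto simp: gr_class_def)
  then show ?thesis by (simp add: gr_ring_def)
qed

text \<open>The filtrations alone put the product into \<open>G (i + k + t)\<close>. Lying one step
  deeper says that the component of degree \<open>i\<close> kills the class of \<open>y\<close>
  times the piece of degree \<open>k\<close>.\<close>

definition ann_rep :: "nat \<Rightarrow> 'a \<Rightarrow> (nat \<Rightarrow> 'a) \<Rightarrow> bool" where
  "ann_rep t y a \<longleftrightarrow>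
     (\<forall>i k. \<forall>m\<in>G k. a i \<odot>\<^bsub>M\<^esub> (y \<odot>\<^bsub>M\<^esub> m) \<in> G (Suc (i + k + t)))"

text \<open>This is the set called \<open>D y\<close> in the overview, with the degree
  \<open>t\<close> of \<open>y\<close> made explicit: the condition of \<open>ann_rep\<close> on a
  component of degree zero.\<close>

definition deg0_ann :: "nat \<Rightarrow> 'a \<Rightarrow> 'a set" where
  "deg0_ann t y = {a \<in> grade R 0. \<forall>k. \<forall>m\<in>G k. a \<odot>\<^bsub>M\<^esub> (y \<odot>\<^bsub>M\<^esub> m) \<in> G (Suc (k + t))}"

end

text \<open>The exponent \<open>N\<close> bounds the degrees in which both filtrations are nonzero,
  so every sequence of representatives defines an element of the graded object.\<close>

locale nilpotent_supermodule = supermodule +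
  fixes N :: nat
  assumes nilpotent: "F N = {\<zero>}"
begin

lemma F_eq_zero:
  assumes "n \<ge> N"
  shows "F n = {\<zero>}"
  using F_antimono[OF assms] nilpotent F_zero[of n] by auto

lemma G_eq_zero:
  assumes "n \<ge> N"
  shows "G n = {\<zero>\<^bsub>M\<^esub>}"
proof -
  have "additive_subgroup {\<zero>\<^bsub>M\<^esub>} M"
    by (intro additive_subgroup.intro M.add.triv_subgroup)
  then have "G n \<subseteq> {\<zero>\<^bsub>M\<^esub>}"
    by (rule G_least) (use F_eq_zero[OF assms] in auto)
  then show ?thesis using G_zero[of n] by blast
qed

lemma F_class_carrier:
  assumes "\<And>n. a n \<in> F n"
  shows "gr_class R F a \<in> carrier gr_R"
  using R.gr_class_in_carrier[of F N a, OF F_subgroup _ nilpotent assms] F_antimono[of _ "Suc _"]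
  by (simp add: gr_ring_def)

lemma G_class_carrier:
  assumes "\<And>n. x n \<in> G n"
  shows "gr_class M G x \<in> carrier gr_M"
  using M.gr_class_in_carrier[of G N x, OF G_subgroup _ _ assms] G_antimono[of _ "Suc _"]
    G_eq_zero[of N]
  by (simp add: gr_module_def)

lemma carrier_gr_M: "carrier gr_M = gr_class M G ` {x. \<forall>n. x n \<in> G n}"
proof
  show "carrier gr_M \<subseteq> gr_class M G ` {x. \<forall>n. x n \<in> G n}"
    by (auto simp: gr_module_def elim: gr_carrierE)
qed (use G_class_carrier in auto)

lemma grade_gr_ring_image:
  "grade gr_R p = gr_class R F ` {a. \<forall>n. a n \<in> F n \<inter> grade R p}"
  unfolding grade_gr_ring using F_class_carrier by auto

lemma gr_degree_one_odd:
  assumes "y \<in> grade R 1"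
  shows "homog 1 y \<in> grade gr_R 1"
proof -
  have "y \<in> F 1"
    using ring_prod_list_power[of "[y]"] odd_in_odd_ideal[OF assms] assms by simp
  then show ?thesis
    unfolding grade_gr_ring_image homog_def using assms by (intro imageI) auto
qed

text \<open>The ring axioms of the even part of \<open>gr R\<close> are inherited from the even Rees algebra, a
  subring of the polynomials over \<open>R\<^sub>0\<close>.\<close>

definition rees where
  "rees = UP (even_ring R) \<lparr>carrier := {a. \<forall>n. a n \<in> F n \<inter> grade R 0}\<rparr>"

text \<open>The filtration vanishes in high degrees, so such a sequence is a polynomial.\<close>

lemma rees_up:
  assumes "\<forall>n. a n \<in> F n \<inter> grade R 0"
  shows "a \<in> up (even_ring R)"
proof
  show "a n \<in> carrier (even_ring R)" for n using assms by simp
  have "a n = \<zero>" if "N < n" for n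
    using assms F_eq_zero[of n] that by auto
  then show "\<exists>n. bound \<zero>\<^bsub>even_ring R\<^esub> n a" by (auto intro!: exI[of _ N])
qed

lemma even_conv_closed:
  assumes "\<forall>n. a n \<in> F n \<inter> grade R 0" "\<forall>n. b n \<in> F n \<inter> grade R 0"
  shows "(\<Oplus>i\<in>{..n}. a i \<otimes> b (n - i)) \<in> F n \<inter> grade R 0"
proof
  show "(\<Oplus>i\<in>{..n}. a i \<otimes> b (n - i)) \<in> F n"
  proof (rule R.finsum_in_additive_subgroup[OF F_subgroup])
    show "(\<lambda>i. a i \<otimes> b (n - i)) \<in> {..n} \<rightarrow> F n"
    proof
      fix i assume "i \<in> {..n}"
      then show "a i \<otimes> b (n - i) \<in> F n" using F_mult[of "a i" i "b (n - i)" "n - i"] assms by simp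
    qed
  qed simp
  show "(\<Oplus>i\<in>{..n}. a i \<otimes> b (n - i)) \<in> grade R 0"
    by (rule finsum_even_ring) (use assms grade_even_even in auto)
qed

lemma rees_simps:
  "carrier rees = {a. \<forall>n. a n \<in> F n \<inter> grade R 0}"
  "\<lbrakk>\<forall>n. a n \<in> F n \<inter> grade R 0; \<forall>n. b n \<in> F n \<inter> grade R 0\<rbrakk> \<Longrightarrow>
    a \<otimes>\<^bsub>rees\<^esub> b = (\<lambda>n. \<Oplus>i\<in>{..n}. a i \<otimes> b (n - i))"
  "\<lbrakk>\<forall>n. a n \<in> F n \<inter> grade R 0; \<forall>n. b n \<in> F n \<inter> grade R 0\<rbrakk> \<Longrightarrow>
    a \<oplus>\<^bsub>rees\<^esub> b = (\<lambda>n. a n \<oplus> b n)"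
  "\<one>\<^bsub>rees\<^esub> = (\<lambda>n. if n = 0 then \<one> else \<zero>)"
  "\<zero>\<^bsub>rees\<^esub> = (\<lambda>_. \<zero>)"
proof -
  show "a \<otimes>\<^bsub>rees\<^esub> b = (\<lambda>n. \<Oplus>i\<in>{..n}. a i \<otimes> b (n - i))"
    if ab: "\<forall>n. a n \<in> F n \<inter> grade R 0" "\<forall>n. b n \<in> F n \<inter> grade R 0"
  proof
    fix n
    have "finsum (even_ring R) (\<lambda>i. a i \<otimes> b (n - i)) {..n} = finsum R (\<lambda>i. a i \<otimes> b (n - i)) {..n}"
      by (rule finsum_even_ring) (use ab grade_even_even in auto)
    then show "(a \<otimes>\<^bsub>rees\<^esub> b) n = (\<Oplus>i\<in>{..n}. a i \<otimes> b (n - i))"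
      using ab[THEN rees_up] by (simp add: rees_def UP_def)
  qed
  show "a \<oplus>\<^bsub>rees\<^esub> b = (\<lambda>n. a n \<oplus> b n)"
    if ab: "\<forall>n. a n \<in> F n \<inter> grade R 0" "\<forall>n. b n \<in> F n \<inter> grade R 0"
    using ab[THEN rees_up] by (simp add: rees_def UP_def)
qed (simp_all add: rees_def UP_def fun_eq_iff)

lemma rees_cring: "cring rees"
proof -
  interpret E: cring "even_ring R" by (rule even_ring_cring)
  interpret U: UP_cring "even_ring R" "UP (even_ring R)"
    by (unfold_locales) simp
  let ?H = "{a. \<forall>n. a n \<in> F n \<inter> grade R 0}"
  have sub: "?H \<subseteq> carrier (UP (even_ring R))"
    using rees_up by (auto simp: UP_def)
  have "subring ?H (UP (even_ring R))"
  proof (rule U.subringI[OF sub])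
    show "\<one>\<^bsub>UP (even_ring R)\<^esub> \<in> ?H" 
      using one_even rees_simps(4) by (simp add: rees_def)
  next
    fix a assume a: "a \<in> ?H"
    have "(\<ominus>\<^bsub>UP (even_ring R)\<^esub> a) n = \<ominus> (a n)" for n
    proof -
      have c: "a \<in> carrier (UP (even_ring R))" using a sub by blast
      have "(\<ominus>\<^bsub>UP (even_ring R)\<^esub> a) n = \<ominus>\<^bsub>even_ring R\<^esub> (a n)"
        using U.coeff_a_inv[OF c, of n] unfolding coeff_UP[OF c] coeff_UP[OF U.UP_a_inv_closed[OF c]] .
      moreover have an: "a n \<in> grade R 0" using a by blast
      have "\<ominus>\<^bsub>even_ring R\<^esub> (a n) = \<ominus> (a n)"
        by (rule E.minus_equality) (use grade_neg[OF an] an in \<open>simp_all add: R.l_neg\<close>)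
      ultimately show ?thesis by simp
    qed
    then show "\<ominus>\<^bsub>UP (even_ring R)\<^esub> a \<in> ?H"
      using a by (auto intro: additive_subgroup.a_inv_closed[OF F_subgroup] grade_neg)
  next
    fix a b assume a: "a \<in> ?H" and b: "b \<in> ?H"
    have "a \<otimes>\<^bsub>UP (even_ring R)\<^esub> b = a \<otimes>\<^bsub>rees\<^esub> b" by (simp add: rees_def)
    also have "\<dots> = (\<lambda>n. \<Oplus>i\<in>{..n}. a i \<otimes> b (n - i))"
      by (rule rees_simps(2)) (use a b in blast)+
    also have "\<dots> \<in> ?H" using even_conv_closed[of a b] a b by blast
    finally show "a \<otimes>\<^bsub>UP (even_ring R)\<^esub> b \<in> ?H" .
    have "a \<oplus>\<^bsub>UP (even_ring R)\<^esub> b = a \<oplus>\<^bsub>rees\<^esub> b" by (simp add: rees_def)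
    also have "\<dots> = (\<lambda>n. a n \<oplus> b n)"
      by (rule rees_simps(3)) (use a b in blast)+
    also have "\<dots> \<in> ?H"
      using a b by (auto intro: additive_subgroup.a_closed[OF F_subgroup] grade_add)
    finally show "a \<oplus>\<^bsub>UP (even_ring R)\<^esub> b \<in> ?H" .
  qed
  then show ?thesis
    using U.subcring_iff[OF sub] U.subcringI' unfolding rees_def by blast
qed

lemma even_gr_cring: "cring (even_ring gr_R)"
proof (rule cring_surj_image[OF rees_cring])
  show "gr_class R F ` carrier rees = carrier (even_ring gr_R)"
    by (simp add: rees_simps grade_gr_ring_image)
qed (auto simp: rees_simps gr_ring_mult_class gr_ring_add_class gr_ring_one gr_ring_zero)

end

section \<open>Annihilators in degree zero\<close>

lemma sdim_cong:
  assumes "carrier N = carrier N'" "smult N = smult N'" "\<zero>\<^bsub>N\<^esub> = \<zero>\<^bsub>N'\<^esub>"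
  shows "sdim S N = sdim S N'"
  using assms by (simp add: sdim_def even_ann_def)

text \<open>Negation is multiplication by \<open>\<ominus> \<one>\<close>, and commutativity makes
  left absorption two-sided.\<close>

lemma (in cring) ideal_of_subset:
  assumes "J \<subseteq> carrier R" "\<zero> \<in> J" "\<And>x y. \<lbrakk>x \<in> J; y \<in> J\<rbrakk> \<Longrightarrow> x \<oplus> y \<in> J"
    and mult: "\<And>x r. \<lbrakk>x \<in> J; r \<in> carrier R\<rbrakk> \<Longrightarrow> r \<otimes> x \<in> J"
  shows "ideal J R"
proof (rule idealI)
  show "ring R" by (rule ring_axioms)
  show "subgroup J (add_monoid R)"
  proof (rule add.subgroupI)
    fix x assume x: "x \<in> J"
    then have "\<ominus> \<one> \<otimes> x \<in> J" by (intro mult) auto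
    then show "\<ominus> x \<in> J" using x assms(1) by (simp add: l_minus subset_iff)
  qed (use assms in auto)
  show "x \<otimes> a \<in> J" if "a \<in> J" "x \<in> carrier R" for a x using mult that by simp
  then show "a \<otimes> x \<in> J" if "a \<in> J" "x \<in> carrier R" for a x
    using m_comm[of a x] that assms(1) by auto
qed

context supermodule
begin

text \<open>The annihilator of a multiple of \<open>M\<close>, with \<open>y = \<one>\<close> giving
  that of \<open>M\<close> itself, so that both are treated uniformly.\<close>

definition even_ann_mult :: "'a \<Rightarrow> 'a set" where
  "even_ann_mult y = {a \<in> grade R 0. \<forall>m\<in>carrier M. a \<odot>\<^bsub>M\<^esub> (y \<odot>\<^bsub>M\<^esub> m) = \<zero>\<^bsub>M\<^esub>}"

lemma even_ann_multiple: "even_ann R (multiple y M) = even_ann_mult y"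
  by (auto simp: even_ann_def even_ann_mult_def)

lemma even_ann_mult_ideal:
  assumes "y \<in> carrier R"
  shows "ideal (even_ann_mult y) (even_ring R)"
  by (rule cring.ideal_of_subset[OF even_ring_cring])
    (use assms in \<open>auto simp: even_ann_mult_def smult_closed smult_l_distr smult_assoc
      grade_add grade_even_even\<close>)

lemma sdim_multiple:
  assumes "y \<in> carrier R"
  shows "sdim R (multiple y M) = chain_dim (even_ring R) (even_ann_mult y)"
  using sdim_eq_chain_dim[OF even_ring_cring, of "multiple y M"] even_ann_mult_ideal[OF assms]
  by (simp add: even_ann_multiple)

lemma sdim_whole: "sdim R M = chain_dim (even_ring R) (even_ann_mult \<one>)"
  using sdim_multiple[OF R.one_closed] sdim_cong[of "multiple \<one> M" M R]
  by (simp add: smult_one)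

lemma deg0_ann_ideal:
  assumes "y \<in> carrier R"
  shows "ideal (deg0_ann t y) (even_ring R)"
proof (rule cring.ideal_of_subset[OF even_ring_cring])
  note carr = G_carrier smult_closed assms
  fix a r assume a: "a \<in> deg0_ann t y" and r: "r \<in> carrier (even_ring R)"
  have "(r \<otimes> a) \<odot>\<^bsub>M\<^esub> (y \<odot>\<^bsub>M\<^esub> m) \<in> G (Suc (k + t))" if "m \<in> G k" for k m
    using F_smult_G[of r 0 "a \<odot>\<^bsub>M\<^esub> (y \<odot>\<^bsub>M\<^esub> m)" "Suc (k + t)"] a r that carr
    by (auto simp: deg0_ann_def smult_assoc)
  then show "r \<otimes>\<^bsub>even_ring R\<^esub> a \<in> deg0_ann t y"
    using a r by (simp add: deg0_ann_def grade_even_even)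
qed (use assms G_carrier in \<open>auto simp: deg0_ann_def smult_closed smult_l_distr grade_add
    additive_subgroup.a_closed[OF G_subgroup]\<close>)

text \<open>An even element killing the multiple of \<open>M\<close> by \<open>y\<close> satisfies
  every condition in \<open>deg0_ann t y\<close>. The larger set has fewer primes above it.\<close>

lemma chain_dim_deg0_ann_le:
  "chain_dim (even_ring R) (deg0_ann t y) \<le> chain_dim (even_ring R) (even_ann_mult y)"
proof (rule chain_dim_mono)
  have "even_ann_mult y \<subseteq> deg0_ann t y"
    using G_carrier by (auto simp: deg0_ann_def even_ann_mult_def)
  then show "even_ann_mult y \<subseteq> P" if "deg0_ann t y \<subseteq> P" for P using that by blast
qed

lemma chain_dim_even_ann_mult_le:
  assumes "y \<in> carrier R"
  shows "chain_dim (even_ring R) (even_ann_mult y) \<le> chain_dim (even_ring R) (even_ann_mult \<one>)"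
proof (rule chain_dim_mono)
  have "even_ann_mult \<one> \<subseteq> even_ann_mult y"
    using assms by (auto simp: even_ann_mult_def smult_one smult_closed)
  then show "even_ann_mult \<one> \<subseteq> P" if "even_ann_mult y \<subseteq> P" for P using that by blast
qed

text \<open>From degree \<open>s\<close> on, each application of \<open>a\<close> gains one step of
  the filtration, so \<open>n\<close> applications gain \<open>n\<close>.\<close>

lemma even_pow_smult:
  fixes n :: nat
  assumes "a \<in> grade R 0" "\<And>k m. \<lbrakk>s \<le> k; m \<in> G k\<rbrakk> \<Longrightarrow> a \<odot>\<^bsub>M\<^esub> m \<in> G (Suc k)"
    and "s \<le> k" "m \<in> G k"
  shows "a [^]\<^bsub>even_ring R\<^esub> n \<in> grade R 0 \<and> (a [^]\<^bsub>even_ring R\<^esub> n) \<odot>\<^bsub>M\<^esub> m \<in> G (k + n)"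
  using assms(3,4)
proof (induct n arbitrary: k m)
  case 0
  then show ?case using one_even smult_one[OF G_carrier] by simp
next
  case (Suc n)
  have 1: "a [^]\<^bsub>even_ring R\<^esub> n \<in> grade R 0 \<and>
      (a [^]\<^bsub>even_ring R\<^esub> n) \<odot>\<^bsub>M\<^esub> (a \<odot>\<^bsub>M\<^esub> m) \<in> G (Suc k + n)"
    by (rule Suc(1)) (use Suc assms in auto)
  then show ?case
    using Suc(3) assms(1) smult_assoc[of "a [^]\<^bsub>even_ring R\<^esub> n" a m] G_carrier
    by (auto simp: grade_even_even)
qed

text \<open>For \<open>s \<le> k\<close> the group \<open>G k\<close> is spanned by elements
  \<open>w (c u)\<close> with \<open>w\<close> the product of a word of length \<open>s\<close> and
  \<open>c u\<close> in \<open>G (k - s)\<close>. Membership of \<open>a\<close> in the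
  \<open>deg0_ann\<close> of that product sends such an element to \<open>G (Suc k)\<close>.\<close>

lemma words_smult_G:
  assumes Y: "Y \<subseteq> grade R 1" "odd_ideal R \<subseteq> Y \<cdot> carrier R"
    and a: "a \<in> grade R 0"
      "\<And>w. \<lbrakk>set w \<subseteq> Y; length w = s\<rbrakk> \<Longrightarrow> a \<in> deg0_ann s (ring_prod_list R w)"
    and m: "s \<le> k" "m \<in> G k"
  shows "a \<odot>\<^bsub>M\<^esub> m \<in> G (Suc k)"
proof -
  have ac: "a \<in> carrier R" using a(1) by simp
  have "a \<odot>\<^bsub>M\<^esub> (c \<odot>\<^bsub>M\<^esub> u) \<in> G (Suc k)" if c: "c \<in> F k" and u: "u \<in> carrier M" for c u
  proof -
    \<comment> \<open>The index is \<open>k\<close>, split into the word length \<open>s\<close> and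
      the remaining exponent.\<close>
    have "F (s + (k - s)) \<subseteq> {c \<in> carrier R. a \<odot>\<^bsub>M\<^esub> (c \<odot>\<^bsub>M\<^esub> u) \<in> G (Suc k)}"
    proof (rule ideal_power_words_induct[OF Y])
      fix w c assume w: "set w \<subseteq> Y" "length w = s" "c \<in> F (k - s)"
      have "ring_prod_list R w \<in> carrier R"
        using w(1) Y(1) by (intro ring_prod_list_closed) auto
      moreover have "a \<odot>\<^bsub>M\<^esub> (ring_prod_list R w \<odot>\<^bsub>M\<^esub> (c \<odot>\<^bsub>M\<^esub> u)) \<in> G (Suc (k - s + s))"
        using a(2)[OF w(1,2)] G_incl[OF w(3) u] unfolding deg0_ann_def by blast
      ultimately show "ring_prod_list R w \<otimes> c \<in> {c \<in> carrier R. a \<odot>\<^bsub>M\<^esub> (c \<odot>\<^bsub>M\<^esub> u) \<in> G (Suc k)}"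
        using F_carrier[OF w(3)] u m(1) by (simp add: smult_assoc)
    next
      fix b c assume "b \<in> {c \<in> carrier R. a \<odot>\<^bsub>M\<^esub> (c \<odot>\<^bsub>M\<^esub> u) \<in> G (Suc k)}"
        and "c \<in> {c \<in> carrier R. a \<odot>\<^bsub>M\<^esub> (c \<odot>\<^bsub>M\<^esub> u) \<in> G (Suc k)}"
      then show "b \<oplus> c \<in> {c \<in> carrier R. a \<odot>\<^bsub>M\<^esub> (c \<odot>\<^bsub>M\<^esub> u) \<in> G (Suc k)}"
        using u ac additive_subgroup.a_closed[OF G_subgroup]
        by (simp add: smult_l_distr[of b c] smult_r_distr smult_closed)
    qed
    then show ?thesis using c m(1) by auto
  qed
  then have "G k \<subseteq> {m \<in> carrier M. a \<odot>\<^bsub>M\<^esub> m \<in> G (Suc k)}"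
    by (intro G_least smult_preimage_subgroup G_subgroup ac) (auto simp: smult_closed F_carrier)
  then show ?thesis using m(2) by blast
qed

end

section \<open>Dimension bounds from nilpotency\<close>

context nilpotent_supermodule
begin

text \<open>An element of \<open>deg0_ann 0 \<one>\<close> raises the filtration of \<open>M\<close>
  by one step everywhere, so its power of exponent \<open>N\<close> annihilates \<open>M\<close>. A
  prime above the annihilator therefore contains the element itself.\<close>

lemma chain_dim_even_ann_le_deg0_ann:
  "chain_dim (even_ring R) (even_ann_mult \<one>) \<le> chain_dim (even_ring R) (deg0_ann 0 \<one>)"
proof (rule chain_dim_mono)
  fix P assume P: "primeideal P (even_ring R)" "even_ann_mult \<one> \<subseteq> P"
  show "deg0_ann 0 \<one> \<subseteq> P"
  proof
    fix a assume a: "a \<in> deg0_ann 0 \<one>"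
    have "a \<odot>\<^bsub>M\<^esub> m \<in> G (Suc k)" if "m \<in> G k" for k m
      using a that by (auto simp: deg0_ann_def smult_one G_carrier)
    then have "a [^]\<^bsub>even_ring R\<^esub> N \<in> grade R 0 \<and> (a [^]\<^bsub>even_ring R\<^esub> N) \<odot>\<^bsub>M\<^esub> m \<in> G (0 + N)"
      if "m \<in> G 0" for m
      using a that by (intro even_pow_smult[where s = 0]) (auto simp: deg0_ann_def)
    then have "a [^]\<^bsub>even_ring R\<^esub> N \<in> even_ann_mult \<one>"
      using G_eq_zero[of N] G_0 G_zero[of 0]
      by (auto simp: even_ann_mult_def smult_one)
    then show "a \<in> P"
      using primeideal_pow[OF P(1)] P(2) a by (auto simp: deg0_ann_def)
  qed
qed

text \<open>The finitely many words of length \<open>s\<close> replace \<open>x\<close>. An element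
  common to all their \<open>deg0_ann\<close> has a power annihilating the multiple of
  \<open>M\<close> by \<open>x\<close>, so a prime above that annihilator contains the intersection,
  hence one of the ideals.\<close>

lemma chain_dim_le_word:
  assumes Y: "finite Y" "Y \<subseteq> grade R 1" "\<zero> \<in> Y" "odd_ideal R \<subseteq> Y \<cdot> carrier R"
    and x: "x \<in> F s"
  shows "\<exists>w. set w \<subseteq> Y \<and> length w = s \<and>
    chain_dim (even_ring R) (even_ann_mult x) \<le>
      chain_dim (even_ring R) (deg0_ann s (ring_prod_list R w))"
proof -
  let ?W = "{w. set w \<subseteq> Y \<and> length w = s}"
  have fin: "finite ?W" using finite_lists_length_eq[OF Y(1)] .
  \<comment> \<open>Zero belongs to \<open>Y\<close>, so words of length \<open>s\<close> exist and
    the maximum is taken over a nonempty set.\<close>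
  have "replicate s \<zero> \<in> ?W" using Y(3) by auto
  then have ne: "?W \<noteq> {}" by blast
  have "\<exists>w\<in>?W. chain_dim (even_ring R) (even_ann_mult x) \<le>
      chain_dim (even_ring R) (deg0_ann s (ring_prod_list R w))"
  proof (rule chain_dim_finite_cover[OF fin ne])
    fix P assume P: "primeideal P (even_ring R)" "even_ann_mult x \<subseteq> P"
    show "\<exists>w\<in>?W. deg0_ann s (ring_prod_list R w) \<subseteq> P"
    proof (rule primeideal_Inter[OF fin P(1)])
      show "ideal (deg0_ann s (ring_prod_list R w)) (even_ring R)" if "w \<in> ?W" for w
        using that Y(2) by (intro deg0_ann_ideal ring_prod_list_closed) auto
      show "carrier (even_ring R) \<inter> (\<Inter>w\<in>?W. deg0_ann s (ring_prod_list R w)) \<subseteq> P"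
      proof
        fix a assume a: "a \<in> carrier (even_ring R) \<inter> (\<Inter>w\<in>?W. deg0_ann s (ring_prod_list R w))"
        then have step: "a \<odot>\<^bsub>M\<^esub> m \<in> G (Suc k)" if "s \<le> k" "m \<in> G k" for k m
          using that by (intro words_smult_G[OF Y(2,4), where s = s]) auto
        have a0: "a \<in> grade R 0" using a by simp
        \<comment> \<open>As \<open>x\<close> lies in \<open>F s\<close>, the element
          \<open>x m\<close> starts in \<open>G s\<close>, where \<open>step\<close> applies;
          \<open>N\<close> steps lead to \<open>G (s + N)\<close>, which is zero.\<close>
        have "a [^]\<^bsub>even_ring R\<^esub> N \<in> grade R 0 \<and>
            (a [^]\<^bsub>even_ring R\<^esub> N) \<odot>\<^bsub>M\<^esub> (x \<odot>\<^bsub>M\<^esub> m) \<in> G (s + N)" if "m \<in> carrier M" for m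
          by (rule even_pow_smult[OF a0 step]) (use G_incl[OF x that] in auto)
        then have "a [^]\<^bsub>even_ring R\<^esub> N \<in> even_ann_mult x"
          using G_eq_zero[of "s + N"] G_0 G_zero[of 0] by (auto simp: even_ann_mult_def)
        then show "a \<in> P"
          using primeideal_pow[OF P(1)] P(2) a by auto
      qed
    qed
  qed
  then show ?thesis by blast
qed

section \<open>Annihilators of homogeneous multiples of the graded module\<close>

lemma homog_smult:
  assumes "y \<in> F t" "\<And>n. x n \<in> G n"
  shows "homog t y \<odot>\<^bsub>gr_M\<^esub> gr_class M G x
    = gr_class M G (\<lambda>n. if t \<le> n then y \<odot>\<^bsub>M\<^esub> x (n - t) else \<zero>\<^bsub>M\<^esub>)"
  unfolding homog_def
  using gr_module_smult_class[of "\<lambda>n. if n = t then y else \<zero>" x, OF _ assms(2)]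
    finsum_smult_single[of y x, OF F_carrier[OF assms(1)] G_carrier[OF assms(2)]] assms(1)
  by simp

lemma smult_shift_G:
  assumes "y \<in> F t" "\<And>n. x n \<in> G n"
  shows "(if t \<le> n then y \<odot>\<^bsub>M\<^esub> x (n - t) else \<zero>\<^bsub>M\<^esub>) \<in> G n"
  using F_smult_G[OF assms(1) assms(2), of "n - t"] by auto

text \<open>Annihilation says that each convolution sum lies one step deeper than its degree.
  Sequences concentrated in a single degree isolate the individual summands; conversely, the
  condition on all summands gives it for the sums.\<close>

lemma annihilates_iff_ann_rep:
  assumes y: "y \<in> F t" and a: "\<And>n. a n \<in> F n"
  shows "(\<forall>h\<in>carrier (multiple (homog t y) gr_M). gr_class R F a \<odot>\<^bsub>gr_M\<^esub> h = \<zero>\<^bsub>gr_M\<^esub>)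
    \<longleftrightarrow> ann_rep t y a"
proof -
  let ?sh = "\<lambda>x n. if t \<le> n then y \<odot>\<^bsub>M\<^esub> x (n - t) else \<zero>\<^bsub>M\<^esub>"
  let ?S = "\<lambda>x n. \<Oplus>\<^bsub>M\<^esub>i\<in>{..n}. a i \<odot>\<^bsub>M\<^esub> ?sh x (n - i)"
  have cl: "a i \<odot>\<^bsub>M\<^esub> ?sh x j \<in> carrier M" if "\<And>n. x n \<in> G n" for x i j
    using smult_closed F_carrier[OF a] G_carrier[OF smult_shift_G[OF y that]] by blast
  have S: "?S x n \<in> carrier M" if "\<And>n. x n \<in> G n" for x n
    using cl[OF that] by (intro M.finsum_closed) auto
  have "(\<forall>h\<in>carrier (multiple (homog t y) gr_M). gr_class R F a \<odot>\<^bsub>gr_M\<^esub> h = \<zero>\<^bsub>gr_M\<^esub>) \<longleftrightarrow>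
      (\<forall>x. (\<forall>n. x n \<in> G n) \<longrightarrow>
        gr_class R F a \<odot>\<^bsub>gr_M\<^esub> (homog t y \<odot>\<^bsub>gr_M\<^esub> gr_class M G x) = \<zero>\<^bsub>gr_M\<^esub>)"
    unfolding multiple_simps carrier_gr_M by blast
  also have "\<dots> \<longleftrightarrow> (\<forall>x. (\<forall>n. x n \<in> G n) \<longrightarrow> (\<forall>n. ?S x n \<in> G (Suc n)))"
  proof -
    have "gr_class R F a \<odot>\<^bsub>gr_M\<^esub> (homog t y \<odot>\<^bsub>gr_M\<^esub> gr_class M G x) = \<zero>\<^bsub>gr_M\<^esub> \<longleftrightarrow>
        (\<forall>n. ?S x n \<in> G (Suc n))" if x: "\<And>n. x n \<in> G n" for x
      unfolding homog_smult[OF y x]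
        gr_module_smult_class[of a "?sh x", OF a smult_shift_G[OF y x]]
      by (rule gr_module_class_zero_iff) (rule S[OF x])
    then show ?thesis by blast
  qed
  also have "\<dots> \<longleftrightarrow> ann_rep t y a"
  proof
    assume *: "\<forall>x. (\<forall>n. x n \<in> G n) \<longrightarrow> (\<forall>n. ?S x n \<in> G (Suc n))"
    show "ann_rep t y a"
      unfolding ann_rep_def
    proof (intro allI ballI)
      fix i k m assume m: "m \<in> G k"
      \<comment> \<open>With \<open>m\<close> placed in degree \<open>k\<close> and \<open>y\<close>
        in degree \<open>t\<close>, the summand with index \<open>i\<close> is the one that survives
        in total degree \<open>i + k + t\<close>.\<close>
      let ?x = "\<lambda>n. if n = k then m else \<zero>\<^bsub>M\<^esub>"
      let ?n = "i + k + t"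
      have x: "?x n \<in> G n" for n using m by simp
      have ym: "a i \<odot>\<^bsub>M\<^esub> (y \<odot>\<^bsub>M\<^esub> m) \<in> carrier M"
        using smult_closed F_carrier[OF a] F_carrier[OF y] G_carrier[OF m] by blast
      have "?S ?x ?n = (\<Oplus>\<^bsub>M\<^esub>j\<in>{..?n}. if i = j then a j \<odot>\<^bsub>M\<^esub> (y \<odot>\<^bsub>M\<^esub> m) else \<zero>\<^bsub>M\<^esub>)"
      proof (rule M.finsum_cong')
        fix j assume j: "j \<in> {..?n}"
        show "a j \<odot>\<^bsub>M\<^esub> ?sh ?x (?n - j) = (if i = j then a j \<odot>\<^bsub>M\<^esub> (y \<odot>\<^bsub>M\<^esub> m) else \<zero>\<^bsub>M\<^esub>)"
        proof (cases "i = j")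
          case True
          then show ?thesis by auto
        next
          case False
          then have "?sh ?x (?n - j) = \<zero>\<^bsub>M\<^esub>" using j F_carrier[OF y] by auto
          then show ?thesis using False F_carrier[OF a] by simp
        qed
      qed (use ym in auto)
      also have "\<dots> = a i \<odot>\<^bsub>M\<^esub> (y \<odot>\<^bsub>M\<^esub> m)"
        by (rule M.add.finprod_singleton)
          (use smult_closed F_carrier[OF a] F_carrier[OF y] G_carrier[OF m] in auto)
      finally show "a i \<odot>\<^bsub>M\<^esub> (y \<odot>\<^bsub>M\<^esub> m) \<in> G (Suc (i + k + t))"
        using *[rule_format, of ?x ?n] x by simp
    qed
  next
    assume ann: "ann_rep t y a"
    show "\<forall>x. (\<forall>n. x n \<in> G n) \<longrightarrow> (\<forall>n. ?S x n \<in> G (Suc n))"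
    proof (intro allI impI)
      fix x n assume x: "\<forall>n. x n \<in> G n"
      show "?S x n \<in> G (Suc n)"
      proof (rule M.finsum_in_additive_subgroup[OF G_subgroup])
        show "(\<lambda>i. a i \<odot>\<^bsub>M\<^esub> ?sh x (n - i)) \<in> {..n} \<rightarrow> G (Suc n)"
        proof
          fix i assume i: "i \<in> {..n}"
          show "a i \<odot>\<^bsub>M\<^esub> ?sh x (n - i) \<in> G (Suc n)"
          proof (cases "t \<le> n - i")
            case True
            \<comment> \<open>The degree is \<open>n - i - t\<close>; as
              \<open>t \<le> n - i\<close>, the truncated subtractions are exact and the total is
              \<open>n\<close>.\<close>
            have "a i \<odot>\<^bsub>M\<^esub> (y \<odot>\<^bsub>M\<^esub> x (n - i - t)) \<in> G (Suc (i + (n - i - t) + t))"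
              using ann x unfolding ann_rep_def by blast
            then show ?thesis using True i by simp
          next
            case False
            then show ?thesis using F_carrier[OF a] by simp
          qed
        qed
      qed simp
    qed
  qed
  finally show ?thesis .
qed

lemma even_ann_homog:
  assumes y: "y \<in> F t"
  shows "even_ann gr_R (multiple (homog t y) gr_M)
    = gr_class R F ` {a. (\<forall>n. a n \<in> F n \<inter> grade R 0) \<and> ann_rep t y a}"
proof -
  have "(\<forall>h\<in>carrier (multiple (homog t y) gr_M).
      gr_class R F a \<odot>\<^bsub>multiple (homog t y) gr_M\<^esub> h = \<zero>\<^bsub>multiple (homog t y) gr_M\<^esub>) \<longleftrightarrow> ann_rep t y a"
    if "\<forall>n. a n \<in> F n \<inter> grade R 0" for a
    unfolding multiple_simps(2,3) by (rule annihilates_iff_ann_rep[OF y]) (use that in blast)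
  then show ?thesis unfolding even_ann_def grade_gr_ring_image by blast
qed

text \<open>The ideal properties are verified on representatives through \<open>ann_rep\<close>,
  with no appeal to module axioms for \<open>gr_M\<close>.\<close>

lemma even_ann_homog_ideal:
  assumes y: "y \<in> F t"
  shows "ideal (even_ann gr_R (multiple (homog t y) gr_M)) (even_ring gr_R)"
proof (rule cring.ideal_of_subset[OF even_gr_cring])
  let ?J = "even_ann gr_R (multiple (homog t y) gr_M)"
  note yc = F_carrier[OF y]
  show "?J \<subseteq> carrier (even_ring gr_R)" by (auto simp: even_ann_def)
  show "\<zero>\<^bsub>even_ring gr_R\<^esub> \<in> ?J"
    unfolding even_ann_homog[OF y] even_ring_simps gr_ring_zero
    by (intro imageI) (auto simp: ann_rep_def yc G_carrier smult_closed)
  show "f \<oplus>\<^bsub>even_ring gr_R\<^esub> g \<in> ?J" if fg: "f \<in> ?J" "g \<in> ?J" for f g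
  proof -
    obtain a b where a: "\<forall>n. a n \<in> F n \<inter> grade R 0" "ann_rep t y a" "f = gr_class R F a"
      and b: "\<forall>n. b n \<in> F n \<inter> grade R 0" "ann_rep t y b" "g = gr_class R F b"
      using fg unfolding even_ann_homog[OF y] by blast
    have "f \<oplus>\<^bsub>even_ring gr_R\<^esub> g = gr_class R F (\<lambda>n. a n \<oplus> b n)"
      unfolding a b even_ring_simps by (rule gr_ring_add_class) (use a b in blast)+
    moreover have "ann_rep t y (\<lambda>n. a n \<oplus> b n)"
      unfolding ann_rep_def
    proof (intro allI ballI)
      fix i k m assume m: "m \<in> G k"
      have "a i \<odot>\<^bsub>M\<^esub> (y \<odot>\<^bsub>M\<^esub> m) \<oplus>\<^bsub>M\<^esub> b i \<odot>\<^bsub>M\<^esub> (y \<odot>\<^bsub>M\<^esub> m) \<in> G (Suc (i + k + t))"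
        using a(2) b(2) m unfolding ann_rep_def
        by (intro additive_subgroup.a_closed[OF G_subgroup]) auto
      then show "(a i \<oplus> b i) \<odot>\<^bsub>M\<^esub> (y \<odot>\<^bsub>M\<^esub> m) \<in> G (Suc (i + k + t))"
        using a(1) b(1) smult_closed[OF yc G_carrier[OF m]]
        by (subst smult_l_distr) (auto intro: F_carrier)
    qed
    ultimately show ?thesis
      unfolding even_ann_homog[OF y]
      using a(1) b(1) additive_subgroup.a_closed[OF F_subgroup] grade_add by auto
  qed
  show "f \<otimes>\<^bsub>even_ring gr_R\<^esub> g \<in> ?J" if fg: "g \<in> ?J" "f \<in> carrier (even_ring gr_R)" for f g
  proof -
    obtain b where b: "\<forall>n. b n \<in> F n \<inter> grade R 0" "ann_rep t y b" "g = gr_class R F b"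
      using fg unfolding even_ann_homog[OF y] by blast
    obtain a where a: "\<forall>n. a n \<in> F n \<inter> grade R 0" "f = gr_class R F a"
      using fg unfolding even_ring_simps grade_gr_ring_image by blast
    let ?c = "\<lambda>n. \<Oplus>i\<in>{..n}. a i \<otimes> b (n - i)"
    have "f \<otimes>\<^bsub>even_ring gr_R\<^esub> g = gr_class R F ?c"
      unfolding a b even_ring_simps by (rule gr_ring_mult_class) (use a b in blast)+
    moreover have "ann_rep t y ?c"
      unfolding ann_rep_def
    proof (intro allI ballI)
      fix n k m assume m: "m \<in> G k"
      have ym: "y \<odot>\<^bsub>M\<^esub> m \<in> carrier M" using smult_closed[OF yc G_carrier[OF m]] .
      have ac: "a i \<in> carrier R" and bc: "b i \<in> carrier R" for i
        using a b by (auto intro: F_carrier)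
      have "?c n \<odot>\<^bsub>M\<^esub> (y \<odot>\<^bsub>M\<^esub> m) = (\<Oplus>\<^bsub>M\<^esub>i\<in>{..n}. (a i \<otimes> b (n - i)) \<odot>\<^bsub>M\<^esub> (y \<odot>\<^bsub>M\<^esub> m))"
        by (rule finsum_smult_distr) (use ac bc ym in auto)
      also have "\<dots> \<in> G (Suc (n + k + t))"
      proof (rule M.finsum_in_additive_subgroup[OF G_subgroup])
        show "(\<lambda>i. (a i \<otimes> b (n - i)) \<odot>\<^bsub>M\<^esub> (y \<odot>\<^bsub>M\<^esub> m)) \<in> {..n} \<rightarrow> G (Suc (n + k + t))"
        proof
          fix i assume i: "i \<in> {..n}"
          have "b (n - i) \<odot>\<^bsub>M\<^esub> (y \<odot>\<^bsub>M\<^esub> m) \<in> G (Suc (n - i + k + t))"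
            using b(2) m unfolding ann_rep_def by blast
          moreover have "a i \<in> F i" using a by blast
          ultimately have "a i \<odot>\<^bsub>M\<^esub> (b (n - i) \<odot>\<^bsub>M\<^esub> (y \<odot>\<^bsub>M\<^esub> m)) \<in> G (i + Suc (n - i + k + t))"
            by (intro F_smult_G)
          then show "(a i \<otimes> b (n - i)) \<odot>\<^bsub>M\<^esub> (y \<odot>\<^bsub>M\<^esub> m) \<in> G (Suc (n + k + t))"
            using i ac bc ym by (simp add: smult_assoc)
        qed
      qed simp
      finally show "?c n \<odot>\<^bsub>M\<^esub> (y \<odot>\<^bsub>M\<^esub> m) \<in> G (Suc (n + k + t))" .
    qed
    ultimately show ?thesis
      unfolding even_ann_homog[OF y] using even_conv_closed[OF a(1) b(1)] by blast
  qed
qed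

lemma sdim_homog:
  assumes y: "y \<in> F t"
  shows "sdim gr_R (multiple (homog t y) gr_M)
    = chain_dim (even_ring gr_R) (even_ann gr_R (multiple (homog t y) gr_M))"
proof (rule sdim_eq_chain_dim[OF even_gr_cring even_ann_homog_ideal[OF y]])
  fix f assume "f \<in> grade gr_R 0"
  then obtain a where a: "\<forall>n. a n \<in> F n \<inter> grade R 0" "f = gr_class R F a"
    unfolding grade_gr_ring_image by blast
  have "f \<odot>\<^bsub>gr_M\<^esub> \<zero>\<^bsub>gr_M\<^esub> = gr_class M G (\<lambda>n. \<Oplus>\<^bsub>M\<^esub>i\<in>{..n}. a i \<odot>\<^bsub>M\<^esub> \<zero>\<^bsub>M\<^esub>)"
    unfolding a gr_module_zero by (rule gr_module_smult_class) (use a in auto)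
  also have "\<dots> = \<zero>\<^bsub>gr_M\<^esub>"
    unfolding gr_module_zero using a
    by (intro arg_cong[where f = "gr_class M G"] ext M.add.finprod_one_eqI smult_zero_right)
      (auto intro: F_carrier)
  finally show "f \<odot>\<^bsub>multiple (homog t y) gr_M\<^esub> \<zero>\<^bsub>multiple (homog t y) gr_M\<^esub>
      = \<zero>\<^bsub>multiple (homog t y) gr_M\<^esub>" by simp
qed

text \<open>The class of one in degree zero acts as the identity, so \<open>gr_M\<close> is itself
  one of the homogeneous multiples.\<close>

lemma sdim_gr_M: "sdim gr_R gr_M = sdim gr_R (multiple (homog 0 \<one>) gr_M)"
proof -
  have "homog 0 \<one> \<odot>\<^bsub>gr_M\<^esub> h = h" if "h \<in> carrier gr_M" for h
  proof -
    obtain x where x: "\<forall>n. x n \<in> G n" "h = gr_class M G x"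
      using \<open>h \<in> carrier gr_M\<close> unfolding carrier_gr_M by blast
    have "\<one> \<odot>\<^bsub>M\<^esub> x n = x n" for n using smult_one[OF G_carrier] x(1) by blast
    then show ?thesis
      unfolding x using homog_smult[of \<one> 0 x] x(1) by simp
  qed
  then show ?thesis by (intro sdim_cong) auto
qed

text \<open>Without a component of degree zero, each further factor raises the lowest possible
  degree by one.\<close>

lemma nilpotent_gr:
  fixes n :: nat
  assumes "\<forall>n. a n \<in> F n \<inter> grade R 0" "a 0 = \<zero>"
  shows "\<exists>b. (\<forall>j. b j \<in> F j \<inter> grade R 0) \<and> (\<forall>j<n. b j = \<zero>) \<and>
    gr_class R F a [^]\<^bsub>even_ring gr_R\<^esub> n = gr_class R F b"
proof (induct n)
  case 0
  show ?case
    by (rule exI[of _ "\<lambda>n. if n = 0 then \<one> else \<zero>"]) (auto simp: gr_ring_one one_even)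
next
  case (Suc n)
  then obtain b where b: "\<forall>j. b j \<in> F j \<inter> grade R 0" "\<forall>j<n. b j = \<zero>"
    "gr_class R F a [^]\<^bsub>even_ring gr_R\<^esub> n = gr_class R F b" by blast
  let ?c = "\<lambda>j. \<Oplus>i\<in>{..j}. b i \<otimes> a (j - i)"
  have "gr_class R F a [^]\<^bsub>even_ring gr_R\<^esub> Suc n = gr_class R F ?c"
    using gr_ring_mult_class[of b a] b assms by simp
  moreover have "?c j = \<zero>" if "j < Suc n" for j
  proof (rule R.add.finprod_one_eqI)
    fix i assume "i \<in> {..j}"
    \<comment> \<open>Either \<open>i = j\<close> and the other factor is \<open>a 0\<close>, or
      \<open>i < j \<le> n\<close> and \<open>b i\<close> vanishes.\<close>
    then have "b i = \<zero> \<or> a (j - i) = \<zero>" using b(2) assms(2) that by (cases "i = j") auto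
    moreover have "a (j - i) \<in> carrier R" "b i \<in> carrier R"
      using b(1) assms(1) by (auto intro: F_carrier)
    ultimately show "b i \<otimes> a (j - i) = \<zero>" by auto
  qed
  moreover have "\<forall>j. ?c j \<in> F j \<inter> grade R 0" using even_conv_closed[OF b(1) assms(1)] by blast
  ultimately show ?case by (intro exI[of _ ?c]) simp
qed

text \<open>The power of exponent \<open>N\<close> has zero representatives below degree
  \<open>N\<close> by \<open>nilpotent_gr\<close>, and from \<open>N\<close> on because
  \<open>F\<close> vanishes. So the class is nilpotent and lies in every prime.\<close>

lemma primeideal_contains_positive:
  assumes P: "primeideal P (even_ring gr_R)"
    and a: "\<forall>n. a n \<in> F n \<inter> grade R 0" "a 0 = \<zero>"
  shows "gr_class R F a \<in> P"
proof (rule primeideal_pow[OF P])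
  show "gr_class R F a \<in> carrier (even_ring gr_R)"
    using a unfolding even_ring_simps grade_gr_ring_image by blast
  obtain b where b: "\<forall>j. b j \<in> F j \<inter> grade R 0" "\<forall>j<N. b j = \<zero>"
    "gr_class R F a [^]\<^bsub>even_ring gr_R\<^esub> N = gr_class R F b"
    using nilpotent_gr[OF a] by blast
  have "b j = \<zero>" for j using b(1,2) F_eq_zero[of j] by (cases "j < N") auto
  then have "b = (\<lambda>_. \<zero>)" by (rule ext)
  then have "gr_class R F a [^]\<^bsub>even_ring gr_R\<^esub> N = \<zero>\<^bsub>even_ring gr_R\<^esub>"
    using b(3) gr_ring_zero by simp
  also have "\<dots> \<in> P"
    using P primeideal.axioms(1) ideal.axioms(1) additive_subgroup.zero_closed by blast
  finally show "gr_class R F a [^]\<^bsub>even_ring gr_R\<^esub> N \<in> P" .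
qed

end

section \<open>Comparison of dimensions\<close>

context nilpotent_supermodule
begin

lemma F1_coset_even:
  assumes "r \<in> carrier R"
  shows "\<exists>r0\<in>grade R 0. F (Suc 0) +> r = F (Suc 0) +> r0"
proof -
  interpret F1: abelian_subgroup "F (Suc 0)" R by (rule F_abelian_subgroup)
  obtain r0 r1 where r: "r0 \<in> grade R 0" "r1 \<in> grade R 1" "r = r0 \<oplus> r1"
    using homogeneous_decomp[OF assms] .
  have "r1 \<in> F (Suc 0)"
    using ring_prod_list_power[of "[r1]"] odd_in_odd_ideal[OF r(2)] r(2) by simp
  then have "F (Suc 0) +> r = F (Suc 0) +> r0"
    using F1.coset_absorb[of r1 r0] r by (simp add: R.a_comm)
  then show ?thesis using r(1) by blast
qed

text \<open>The residue ring modulo the odd ideal is a quotient both of the even part of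
  \<open>R\<close> and of the even part of \<open>gr_R\<close>, the latter through the component of
  degree zero. It carries chains of primes from one ring to the other.\<close>

lemma degree_zero_quotient:
  "cring (R Quot F (Suc 0))"
  "(\<lambda>a. F (Suc 0) +> a) \<in> ring_hom (even_ring R) (R Quot F (Suc 0))"
  "(\<lambda>a. F (Suc 0) +> a) ` carrier (even_ring R) = carrier (R Quot F (Suc 0))"
  "(\<lambda>f. f 0) \<in> ring_hom (even_ring gr_R) (R Quot F (Suc 0))"
  "(\<lambda>f. f 0) ` carrier (even_ring gr_R) = carrier (R Quot F (Suc 0))"
proof -
  interpret F1: ideal "F (Suc 0)" R by (rule F_ideal)
  note hom = F1.rcos_ring_hom
  show hom0: "(\<lambda>a. F (Suc 0) +> a) \<in> ring_hom (even_ring R) (R Quot F (Suc 0))"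
    using hom by (auto simp: ring_hom_def)
  have carr: "carrier (R Quot F (Suc 0)) = (\<lambda>a. F (Suc 0) +> a) ` carrier R"
    by (auto simp: FactRing_def A_RCOSETS_def')
  show surj: "(\<lambda>a. F (Suc 0) +> a) ` carrier (even_ring R) = carrier (R Quot F (Suc 0))"
    unfolding carr using F1_coset_even by auto
  show "cring (R Quot F (Suc 0))"
    using hom0 F1.a_rcos_const[OF F_zero]
    by (intro cring_surj_image[OF even_ring_cring surj]) (auto simp: ring_hom_def FactRing_def)
  have zero_coset: "gr_class R F a 0 = F (Suc 0) +> a 0" for a by (simp add: gr_class_def)
  have single: "\<exists>f\<in>carrier (even_ring gr_R). f 0 = F (Suc 0) +> a" if "a \<in> grade R 0" for a
    using that unfolding even_ring_simps grade_gr_ring_image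
    by (intro bexI[of _ "homog 0 a"]) (auto simp: homog_def zero_coset)
  show "(\<lambda>f. f 0) ` carrier (even_ring gr_R) = carrier (R Quot F (Suc 0))"
  proof
    show "(\<lambda>f. f 0) ` carrier (even_ring gr_R) \<subseteq> carrier (R Quot F (Suc 0))"
      unfolding even_ring_simps grade_gr_ring_image carr
      by (auto simp: zero_coset intro!: imageI dest!: spec[of _ 0])
    show "carrier (R Quot F (Suc 0)) \<subseteq> (\<lambda>f. f 0) ` carrier (even_ring gr_R)"
    proof
      fix c assume "c \<in> carrier (R Quot F (Suc 0))"
      then obtain a where "a \<in> grade R 0" "c = F (Suc 0) +> a"
        unfolding surj[symmetric] by auto
      moreover from this obtain f where "f \<in> carrier (even_ring gr_R)" "f 0 = F (Suc 0) +> a"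
        using single by blast
      ultimately show "c \<in> (\<lambda>f. f 0) ` carrier (even_ring gr_R)" by (intro image_eqI[of _ _ f]) simp_all
    qed
  qed
  show "(\<lambda>f. f 0) \<in> ring_hom (even_ring gr_R) (R Quot F (Suc 0))"
  proof (rule ring_hom_memI)
    fix f g assume "f \<in> carrier (even_ring gr_R)" "g \<in> carrier (even_ring gr_R)"
    then obtain a b where a: "\<forall>n. a n \<in> F n \<inter> grade R 0" "f = gr_class R F a"
      and b: "\<forall>n. b n \<in> F n \<inter> grade R 0" "g = gr_class R F b"
      unfolding even_ring_simps grade_gr_ring_image by blast
    have ab: "a 0 \<in> carrier R" "b 0 \<in> carrier R" using a(1) b(1) by (auto intro: F_carrier)
    have "(f \<otimes>\<^bsub>gr_R\<^esub> g) 0 = F (Suc 0) +> (a 0 \<otimes> b 0)"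
      unfolding a b using gr_ring_mult_class[of a b] a b ab by (simp add: zero_coset)
    then show "(f \<otimes>\<^bsub>even_ring gr_R\<^esub> g) 0 = f 0 \<otimes>\<^bsub>R Quot F (Suc 0)\<^esub> g 0"
      using F1.rcoset_mult_add[OF ab] by (simp add: FactRing_def a b zero_coset)
    have "(f \<oplus>\<^bsub>gr_R\<^esub> g) 0 = F (Suc 0) +> (a 0 \<oplus> b 0)"
      unfolding a b using gr_ring_add_class[of a b] a b by (simp add: zero_coset)
    then show "(f \<oplus>\<^bsub>even_ring gr_R\<^esub> g) 0 = f 0 \<oplus>\<^bsub>R Quot F (Suc 0)\<^esub> g 0"
      using F1.a_rcos_sum[OF ab] by (simp add: FactRing_def a b zero_coset)
  next
    show "f 0 \<in> carrier (R Quot F (Suc 0))" if "f \<in> carrier (even_ring gr_R)" for f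
      using that unfolding even_ring_simps grade_gr_ring_image carr
      by (auto simp: zero_coset intro!: imageI dest!: spec[of _ 0])
    show "\<one>\<^bsub>even_ring gr_R\<^esub> 0 = \<one>\<^bsub>R Quot F (Suc 0)\<^esub>"
      by (simp add: gr_ring_one zero_coset FactRing_def)
  qed
qed

text \<open>Primes of the even part of \<open>gr_R\<close> contain all classes without a component
  of degree zero, so the annihilator counts through its degree-zero components. These form a subset
  of the common residue ring, whose preimage in the even part of \<open>R\<close> is
  \<open>deg0_ann t y\<close>.\<close>

lemma chain_dim_degree_zero:
  assumes y: "y \<in> F t"
  shows "chain_dim (even_ring gr_R) (even_ann gr_R (multiple (homog t y) gr_M))
    = chain_dim (even_ring R) (deg0_ann t y)"
proof -
  interpret F1: ideal "F (Suc 0)" R by (rule F_ideal)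
  let ?J = "even_ann gr_R (multiple (homog t y) gr_M)"
  let ?C = "R Quot F (Suc 0)"
  let ?T = "(\<lambda>f. f 0) ` ?J"
  have J: "?J \<subseteq> carrier (even_ring gr_R)" by (auto simp: even_ann_def)
  have T: "?T \<subseteq> carrier ?C" using degree_zero_quotient(5) J by blast
  have zJ: "\<zero>\<^bsub>even_ring gr_R\<^esub> \<in> ?J"
    using even_ann_homog_ideal[OF y] ideal.axioms(1) additive_subgroup.zero_closed by blast
  have "\<zero>\<^bsub>even_ring gr_R\<^esub> 0 = \<zero>\<^bsub>?C\<^esub>"
    using F1.a_rcos_const[OF F_zero] by (simp add: gr_ring_zero gr_class_def FactRing_def)
  from image_eqI[where f = "\<lambda>f. f 0", OF this[symmetric] zJ] have T0: "\<zero>\<^bsub>?C\<^esub> \<in> ?T" .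
  have "chain_dim (even_ring gr_R) ?J
      = chain_dim (even_ring gr_R) {f \<in> carrier (even_ring gr_R). f 0 \<in> ?T}"
  proof (rule antisym; rule chain_dim_mono)
    fix P assume P: "primeideal P (even_ring gr_R)" "?J \<subseteq> P"
    show "{f \<in> carrier (even_ring gr_R). f 0 \<in> ?T} \<subseteq> P"
    proof
      fix f assume "f \<in> {f \<in> carrier (even_ring gr_R). f 0 \<in> ?T}"
      then obtain g where f: "f \<in> carrier (even_ring gr_R)" and g: "g \<in> ?J" "f 0 = g 0"
        by (auto elim!: imageE)
      obtain a where a: "\<forall>n. a n \<in> F n \<inter> grade R 0" "f = gr_class R F a"
        using f unfolding even_ring_simps grade_gr_ring_image by blast
      obtain b where b: "\<forall>n. b n \<in> F n \<inter> grade R 0" "g = gr_class R F b"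
        using g(1) unfolding even_ann_homog[OF y] by blast
      \<comment> \<open>The elements \<open>f\<close> and \<open>g\<close> agree in degree zero, so
        their difference is represented by a sequence that is zero there and hence lies in
        \<open>P\<close>.\<close>
      let ?c = "\<lambda>n. if n = 0 then \<zero> else a n \<ominus> b n"
      have c: "\<forall>n. ?c n \<in> F n \<inter> grade R 0"
        using a(1) b(1) additive_subgroup.a_closed[OF F_subgroup]
          additive_subgroup.a_inv_closed[OF F_subgroup]
        by (auto simp: R.minus_eq grade_add grade_neg)
      have "f = gr_class R F (\<lambda>n. ?c n \<oplus> b n)"
      proof
        fix n
        have "a n \<in> carrier R" "b n \<in> carrier R" using a(1) b(1) by (auto intro: F_carrier)
        then show "f n = gr_class R F (\<lambda>n. ?c n \<oplus> b n) n"
          using g(2) unfolding a(2) b(2)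
          by (cases n) (auto simp: gr_class_def R.minus_eq R.a_assoc R.l_neg)
      qed
      also have "\<dots> = gr_class R F ?c \<oplus>\<^bsub>even_ring gr_R\<^esub> g"
        unfolding even_ring_simps b(2)
        by (rule gr_ring_add_class[symmetric]) (use c b in blast)+
      also have "\<dots> \<in> P"
      proof (rule additive_subgroup.a_closed[OF ideal.axioms(1)[OF primeideal.axioms(1)[OF P(1)]]])
        show "gr_class R F ?c \<in> P" by (rule primeideal_contains_positive[OF P(1) c]) simp
        show "g \<in> P" using P(2) g(1) by blast
      qed
      finally show "f \<in> P" .
    qed
  next
    show "?J \<subseteq> P" if "{f \<in> carrier (even_ring gr_R). f 0 \<in> ?T} \<subseteq> P" for P
      using that J by blast
  qed
  also have "\<dots> = chain_dim ?C ?T"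
    by (rule chain_dim_surj_hom[symmetric, OF even_gr_cring degree_zero_quotient(1,4,5) T T0])
  also have "\<dots> = chain_dim (even_ring R) {a \<in> carrier (even_ring R). F (Suc 0) +> a \<in> ?T}"
    by (rule chain_dim_surj_hom[OF even_ring_cring degree_zero_quotient(1,2,3) T T0])
  also have "{a \<in> carrier (even_ring R). F (Suc 0) +> a \<in> ?T} = deg0_ann t y"
  proof (intro subset_antisym subsetI)
    fix a assume "a \<in> {a \<in> carrier (even_ring R). F (Suc 0) +> a \<in> ?T}"
    then obtain b where a: "a \<in> grade R 0"
      and b: "\<forall>n. b n \<in> F n \<inter> grade R 0" "ann_rep t y b" "F (Suc 0) +> a = F (Suc 0) +> b 0"
      unfolding even_ann_homog[OF y] by (auto simp: gr_class_def)
    have ab: "a \<in> carrier R" "b 0 \<in> carrier R" using a b(1) by (auto intro: F_carrier)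
    \<comment> \<open>Since \<open>a\<close> and \<open>b 0\<close> differ by an element of
      \<open>F 1\<close>, the difference moves \<open>G (t + k)\<close> one step deeper and does not
      affect the condition.\<close>
    then have d: "a \<ominus> b 0 \<in> F (Suc 0)" using F1.coset_eq_iff b(3) by simp
    have "a \<odot>\<^bsub>M\<^esub> (y \<odot>\<^bsub>M\<^esub> m) \<in> G (Suc (k + t))" if m: "m \<in> G k" for k m
    proof -
      have ym: "y \<odot>\<^bsub>M\<^esub> m \<in> G (t + k)" by (rule F_smult_G[OF y m])
      have "(a \<ominus> b 0) \<odot>\<^bsub>M\<^esub> (y \<odot>\<^bsub>M\<^esub> m) \<in> G (Suc (k + t))"
        using F_smult_G[OF d ym] by (simp add: add.commute)
      moreover have "b 0 \<odot>\<^bsub>M\<^esub> (y \<odot>\<^bsub>M\<^esub> m) \<in> G (Suc (0 + k + t))"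
        using b(2) m unfolding ann_rep_def by blast
      ultimately have "(a \<ominus> b 0) \<odot>\<^bsub>M\<^esub> (y \<odot>\<^bsub>M\<^esub> m) \<oplus>\<^bsub>M\<^esub> b 0 \<odot>\<^bsub>M\<^esub> (y \<odot>\<^bsub>M\<^esub> m) \<in> G (Suc (k + t))"
        using additive_subgroup.a_closed[OF G_subgroup] by simp
      moreover have "a = (a \<ominus> b 0) \<oplus> b 0"
        using ab by (simp add: R.minus_eq R.a_assoc R.l_neg)
      ultimately show ?thesis
        using smult_l_distr[of "a \<ominus> b 0" "b 0" "y \<odot>\<^bsub>M\<^esub> m"] ab G_carrier[OF ym] by simp
    qed
    then show "a \<in> deg0_ann t y" using a unfolding deg0_ann_def by blast
  next
    fix a assume a: "a \<in> deg0_ann t y"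
    \<comment> \<open>Extending \<open>a\<close> by zero in positive degrees gives an element of the
      annihilator with the prescribed component of degree zero.\<close>
    let ?b = "\<lambda>n. if n = 0 then a else \<zero>"
    have "ann_rep t y ?b"
      using a smult_closed[OF F_carrier[OF y] G_carrier] by (auto simp: ann_rep_def deg0_ann_def)
    moreover have "\<forall>n. ?b n \<in> F n \<inter> grade R 0" using a by (auto simp: deg0_ann_def)
    ultimately have "gr_class R F ?b \<in> ?J" unfolding even_ann_homog[OF y] by blast
    moreover have "gr_class R F ?b 0 = F (Suc 0) +> a" by (simp add: gr_class_def)
    ultimately have "F (Suc 0) +> a \<in> ?T" by (intro image_eqI[of _ _ "gr_class R F ?b"]) simp_all
    then show "a \<in> {a \<in> carrier (even_ring R). F (Suc 0) +> a \<in> ?T}"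
      using a by (simp add: deg0_ann_def)
  qed
  finally show ?thesis .
qed

section \<open>Transfer of odd parameters\<close>

lemma sdim_gr_multiple:
  assumes "set ys \<subseteq> grade R 1"
  shows "sdim gr_R (multiple (ring_prod_list gr_R (map (homog 1) ys)) gr_M)
    = chain_dim (even_ring R) (deg0_ann (length ys) (ring_prod_list R ys))"
proof -
  have ys: "set ys \<subseteq> odd_ideal R" using assms odd_in_odd_ideal by blast
  show ?thesis
    unfolding ring_prod_list_homog[OF ys]
    using sdim_homog[OF ring_prod_list_power[OF ys]]
      chain_dim_degree_zero[OF ring_prod_list_power[OF ys]] by simp
qed

text \<open>The degree-zero comparison with \<open>t = 0\<close> and \<open>y = \<one>\<close>
  reduces this to \<open>deg0_ann 0 \<one>\<close> and the annihilator of \<open>M\<close>, which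
  are compared in both directions.\<close>

lemma sdim_gr_eq_sdim: "sdim gr_R gr_M = sdim R M"
proof -
  have "sdim gr_R gr_M = chain_dim (even_ring R) (deg0_ann 0 \<one>)"
    unfolding sdim_gr_M using sdim_homog[of \<one> 0] chain_dim_degree_zero[of \<one> 0] by simp
  then show ?thesis
    using chain_dim_even_ann_le_deg0_ann chain_dim_deg0_ann_le[of 0 \<one>] sdim_whole
    by (simp add: antisym)
qed

lemma sdim_multiple_le:
  assumes "set ys \<subseteq> grade R 1"
  shows "sdim gr_R (multiple (ring_prod_list gr_R (map (homog 1) ys)) gr_M)
      \<le> sdim R (multiple (ring_prod_list R ys) M)"
    "sdim R (multiple (ring_prod_list R ys) M) \<le> sdim R M"
proof -
  have carr: "ring_prod_list R ys \<in> carrier R"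
    using assms by (intro ring_prod_list_closed) auto
  show "sdim gr_R (multiple (ring_prod_list gr_R (map (homog 1) ys)) gr_M)
      \<le> sdim R (multiple (ring_prod_list R ys) M)"
    unfolding sdim_gr_multiple[OF assms] sdim_multiple[OF carr] by (rule chain_dim_deg0_ann_le)
  show "sdim R (multiple (ring_prod_list R ys) M) \<le> sdim R M"
    unfolding sdim_multiple[OF carr] sdim_whole by (rule chain_dim_even_ann_mult_le[OF carr])
qed

text \<open>The dimension of the multiple of \<open>M\<close> is squeezed between that of the
  multiple of \<open>gr_M\<close> and that of \<open>M\<close>, and these two agree by hypothesis
  and \<open>sdim_gr_eq_sdim\<close>.\<close>

lemma odd_parameters_of_gr:
  assumes "set ys \<subseteq> grade R 1" "odd_parameters gr_R gr_M (map (homog 1) ys)"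
  shows "odd_parameters R M ys"
  using assms sdim_multiple_le[OF assms(1)] sdim_gr_eq_sdim
  by (auto simp: odd_parameters_def)

text \<open>The parameters found are classes of generators from \<open>Y\<close>, not of the given
  \<open>xs\<close>: the product of \<open>xs\<close> may lie in a deeper power, in which case its
  class in degree \<open>length xs\<close> is zero.\<close>

lemma odd_parameters_gr_exist:
  assumes Y: "finite Y" "Y \<subseteq> grade R 1" "\<zero> \<in> Y" "odd_ideal R \<subseteq> Y \<cdot> carrier R"
    and xs: "odd_parameters R M xs"
  shows "\<exists>w. length w = length xs \<and> odd_parameters gr_R gr_M (map (homog 1) w)"
proof -
  have sub: "set xs \<subseteq> grade R 1" using xs by (simp add: odd_parameters_def)
  then have pow: "ring_prod_list R xs \<in> F (length xs)"
    using odd_in_odd_ideal by (intro ring_prod_list_power) blast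
  obtain w where w: "set w \<subseteq> Y" "length w = length xs"
    "chain_dim (even_ring R) (even_ann_mult (ring_prod_list R xs)) \<le>
      chain_dim (even_ring R) (deg0_ann (length xs) (ring_prod_list R w))"
    using chain_dim_le_word[OF Y pow] by blast
  have wodd: "set w \<subseteq> grade R 1" using w(1) Y(2) by blast
  have "sdim R M \<le> sdim gr_R (multiple (ring_prod_list gr_R (map (homog 1) w)) gr_M)"
    using w xs unfolding sdim_gr_multiple[OF wodd] odd_parameters_def
      sdim_multiple[OF F_carrier[OF pow]] by simp
  then have "sdim gr_R (multiple (ring_prod_list gr_R (map (homog 1) w)) gr_M) = sdim gr_R gr_M"
    using sdim_multiple_le[OF wodd] sdim_gr_eq_sdim by auto
  then show ?thesis
    using w(2) xs wodd gr_degree_one_odd unfolding odd_parameters_def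
    by (intro exI[of _ w]) auto
qed

end

section \<open>Lifting longest systems of odd parameters\<close>

theorem corollary5p6:
  fixes R :: "('a, 'm) super_ring_scheme"
    and M :: "('a, 'b, 'k) super_module_scheme"
    and z :: "'a set list"
    and y :: "'a list"
  assumes "noetherian_super_ring R"
    and "Kdim (even_ring R) < \<infinity>"
    and "supermodule R M"
    and "carrier M \<noteq> {\<zero>\<^bsub>M\<^esub>}"
    and "fin_gen R M"
    and "set z \<subseteq> (\<lambda>x. ideal_power R (odd_ideal R) 2 +>\<^bsub>R\<^esub> x) ` odd_ideal R"
    and "longest_odd_parameters (gr_ring R (odd_ideal R)) (gr_module R (odd_ideal R) M)
           (map (gr_degree_one R (odd_ideal R)) z)"
    and "length y = length z"
    and "\<forall>i<length z. y ! i \<in> grade R 1 \<and> z ! i = ideal_power R (odd_ideal R) 2 +>\<^bsub>R\<^esub> (y ! i)"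
  shows "longest_odd_parameters R M y"
proof -
  interpret supermodule R M by fact
  obtain Y where Y: "finite Y" "Y \<subseteq> grade R 1" "\<zero>\<^bsub>R\<^esub> \<in> Y"
    "odd_ideal R \<subseteq> Y \<cdot>\<^bsub>R\<^esub> carrier R"
    using noetherian_odd_generators[OF assms(1)] .
  interpret nilpotent_supermodule R M "Suc (card Y)"
    by unfold_locales (rule odd_ideal_nilpotent[OF Y(1,2,4)])
  have y: "set y \<subseteq> grade R 1" using assms(8,9) by (auto simp: in_set_conv_nth)
  \<comment> \<open>Each \<open>z ! i\<close> is the coset of \<open>y ! i\<close>, so the given
    elements of degree one are the classes of the chosen representatives.\<close>
  have z: "map (gr_degree_one R (odd_ideal R)) z = map (homog 1) y"
    using assms(8,9) by (intro nth_equalityI) (auto simp: gr_degree_one_eq_homog)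
  have "odd_parameters R M y"
    using assms(7) odd_parameters_of_gr[OF y] unfolding z longest_odd_parameters_def by blast
  \<comment> \<open>A system of \<open>M\<close> produces one of \<open>gr_M\<close> of the same
    length, which maximality of \<open>z\<close> bounds.\<close>
  moreover have "length xs \<le> length y" if "odd_parameters R M xs" for xs
    using assms(7) odd_parameters_gr_exist[OF Y that] unfolding z longest_odd_parameters_def
    by fastforce
  ultimately show ?thesis unfolding longest_odd_parameters_def by blast
qed

end
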